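(* Let $A$ and $B$ be $C^*$-algebras and let $V$ be a Hilbert $A$-$B$-bimodule. Then $(QM(V),RM(A),LM(B),\Gamma)$ is a maximal strictly essential quasi extension of $V$, where $\Gamma\colon V\to QM(V)$ is given by $\Gamma(x)(a,b)=axb$ for $x\in V$, $a\in A$, $b\in B$.
   Context: A Hilbert $A$-$B$-bimodule $V$ is both a left Hilbert $A$-module and a right Hilbert $B$-module, with commuting actions, whose inner products satisfy ${}_A\langle x,y\rangle z=x\langle y,z\rangle_B$ for all $x,y,z\in V$. (The two norms on $V$ coming from the two inner products coincide.) $LM(B)$ is the Banach algebra of bounded right $B$-linear maps $B\to B$ with composition as multiplication; $B\subset LM(B)$ via $b\mapsto(b'\mapsto bb')$, so $B$ is a left ideal in $LM(B)$. $RM(A)$ is the Banach algebra of bounded left $A$-linear maps $A\to A$ with the opposite multiplication $\alpha_1\cdot\alpha_2=\alpha_2\circ\alpha_1$; $A\subset RM(A)$ via $a\mapsto(a'\mapsto a'a)$, so $A$ is a right ideal in $RM(A)$. $QM(V)$ is the Banach space of bounded bilinear maps $q\colon A\times B\to V$ with $q(ca,bd)=c\,q(a,b)\,d$ for $a,c\in A$, $b,d\in B$, with norm $\|q\|=\sup\{\|q(a,b)\| : \|a\|\le1,\|b\|\le1\}$. It is a Banach $RM(A)$-$LM(B)$-bimodule via $(\alpha\lhd q)(a,b)=q(\alpha(a),b)$ and $(q\rhd\beta)(a,b)=q(a,\beta(b))$ for $\alpha\in RM(A)$, $\beta\in LM(B)$. For Banach algebras $\mathcal A,\mathcal B$, a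 Banach $\mathcal A$-$\mathcal B$-bimodule is a Banach space equipped with a norm continuous left action of $\mathcal A$ and a norm continuous right action of $\mathcal B$ which commute. A quasi extension $(W,\mathcal A,\mathcal B,\Phi)$ of $V$ consists of: (i) Banach algebras $\mathcal A,\mathcal B$ such that $A\subset\mathcal A$ is a right ideal and $B\subset\mathcal B$ is a left ideal; (ii) a Banach $\mathcal A$-$\mathcal B$-bimodule $W$; (iii) an isometric bimodule homomorphism $\Phi\colon V\to W$ (i.e. $\Phi(axb)=a\Phi(x)b$ for $a\in A$, $b\in B$) with $\mathrm{Im}(\Phi)=AWB:=\overline{\mathrm{span}\{axb : a\in A,x\in W,b\in B\}}$. It is strictly essential if $\|\alpha\|=\sup\{\|a\alpha\| : a\in A,\|a\|\le1\}$ for all $\alpha\in\mathcal A$, $\|\beta\|=\sup\{\|\beta b\| : b\in B,\|b\|\le1\}$ for all $\beta\in\mathcal B$, and $\|y\|=\sup\{\|ayb\| : a\in A,b\in B,\|a\|\le1,\|b\|\le1\}$ for all $y\in W$. A strictly essential quasi extension $(\widehat W,\widehat{\mathcal A},\widehat{\mathcal B},\widehat\Phi)$ of $V$ is maximal if for every strictly essential quasi extension $(W,\mathcal A,\mathcal B,\Phi)$ of $V$ there are an isometric homomorphism $\lambda\colon\mathcal A\to\widehat{\mathcal A}$ which is the identity on $A$, an isometric homomorphism $\mu\colon\mathcal B\to\widehat{\mathcal B}$ which is the identity on $B$, and an isometric linear map $\Theta\colon W\to\widehat W$ such that $\Theta(ayb)=\lambda(a)\Theta(y)\mu(b)$ for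 all $a\in\mathcal A$, $y\in W$, $b\in\mathcal B$, and $\Theta\circ\Phi=\widehat\Phi$. *)

theory Defs
  imports "HOL-Analysis.Analysis"
begin

section \<open>Complex Banach spaces and \<open>C\<^sup>*\<close>-algebras\<close>

class scaleC =
  fixes scaleC :: "complex \<Rightarrow> 'a \<Rightarrow> 'a"  (infixr \<open>*\<^sub>C\<close> 75)

class complex_normed_vector = real_normed_vector + scaleC +
  assumes scaleC_add_right: "c *\<^sub>C (x + y) = c *\<^sub>C x + c *\<^sub>C y"
    and scaleC_add_left: "(c + d) *\<^sub>C x = c *\<^sub>C x + d *\<^sub>C x"
    and scaleC_scaleC: "c *\<^sub>C d *\<^sub>C x = (c * d) *\<^sub>C x"
    and scaleC_of_real: "complex_of_real r *\<^sub>C x = r *\<^sub>R x"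
    and norm_scaleC: "norm (c *\<^sub>C x) = cmod c * norm x"

class cbanach = complex_normed_vector + banach

lemma vector_space_scaleC:
  "vector_space (scaleC :: complex \<Rightarrow> 'a \<Rightarrow> 'a::complex_normed_vector)"
proof
  fix x :: 'a
  show "1 *\<^sub>C x = x"
    using scaleC_of_real[of 1 x] by simp
qed (simp_all add: scaleC_add_right scaleC_add_left scaleC_scaleC)

global_interpretation complex_vector:
  vector_space "scaleC :: complex \<Rightarrow> 'a \<Rightarrow> 'a::complex_normed_vector"
  by (rule vector_space_scaleC)

text \<open>Algebras are not assumed to be unital.\<close>

class cstar_algebra = cbanach + real_normed_algebra +
  fixes star :: "'a \<Rightarrow> 'a"
  assumes mult_scaleC_left: "(c *\<^sub>C x) * y = c *\<^sub>C (x * y)"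
    and mult_scaleC_right: "x * (c *\<^sub>C y) = c *\<^sub>C (x * y)"
    and star_add: "star (x + y) = star x + star y"
    and star_scaleC: "star (c *\<^sub>C x) = cnj c *\<^sub>C star x"
    and star_mult: "star (x * y) = star y * star x"
    and star_star: "star (star x) = x"
    and norm_star_mult: "norm (star x * x) = (norm x)\<^sup>2"

definition positive :: "'a::cstar_algebra \<Rightarrow> bool"
  where "positive a \<longleftrightarrow> (\<exists>c. a = star c * c)"

instantiation blinfun :: (real_normed_vector, complex_normed_vector) complex_normed_vector
begin

lift_definition scaleC_blinfun :: "complex \<Rightarrow> 'a \<Rightarrow>\<^sub>L 'b \<Rightarrow> 'a \<Rightarrow>\<^sub>L 'b"
  is "\<lambda>c f x. c *\<^sub>C f x"
proof -
  fix c :: complex and f :: "'a \<Rightarrow> 'b"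
  assume "bounded_linear f"
  then interpret f: bounded_linear f .
  have real: "c *\<^sub>C r *\<^sub>R y = r *\<^sub>R c *\<^sub>C y" for r :: real and y :: 'b
    by (simp add: scaleC_of_real[symmetric] scaleC_scaleC mult.commute)
  obtain K where K: "\<And>x. norm (f x) \<le> norm x * K"
    using f.bounded by blast
  show "bounded_linear (\<lambda>x. c *\<^sub>C f x)"
  proof (rule bounded_linear_intro[where K = "cmod c * K"])
    fix x
    show "norm (c *\<^sub>C f x) \<le> norm x * (cmod c * K)"
      using mult_left_mono[OF K[of x], of "cmod c"] by (simp add: norm_scaleC mult_ac)
  qed (simp_all add: f.add f.scaleR scaleC_add_right real)
qed

instance
proof
  fix c d :: complex and r :: real and f g :: "'a \<Rightarrow>\<^sub>L 'b"
  show "c *\<^sub>C (f + g) = c *\<^sub>C f + c *\<^sub>C g"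
    by transfer (simp add: scaleC_add_right)
  show "(c + d) *\<^sub>C f = c *\<^sub>C f + d *\<^sub>C f"
    by transfer (simp add: scaleC_add_left)
  show "c *\<^sub>C d *\<^sub>C f = (c * d) *\<^sub>C f"
    by transfer (simp add: scaleC_scaleC)
  show "complex_of_real r *\<^sub>C f = r *\<^sub>R f"
    by transfer (simp add: scaleC_of_real)
  have le: "norm (c *\<^sub>C h) \<le> cmod c * norm h" for c and h :: "'a \<Rightarrow>\<^sub>L 'b"
  proof (rule norm_blinfun_bound)
    fix x
    show "norm (blinfun_apply (c *\<^sub>C h) x) \<le> cmod c * norm h * norm x"
      using mult_left_mono[OF norm_blinfun[of h x], of "cmod c"]
      by (simp add: scaleC_blinfun.rep_eq norm_scaleC mult_ac)
  qed simp
  show "norm (c *\<^sub>C f) = cmod c * norm f"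
  proof (cases "c = 0")
    case True
    then show ?thesis
      using le[of c f] by simp
  next
    case False
    have "inverse c *\<^sub>C c *\<^sub>C f = f"
      using False by (intro blinfun_eqI) (simp add: scaleC_blinfun.rep_eq scaleC_scaleC)
    then have "norm f \<le> cmod (inverse c) * norm (c *\<^sub>C f)"
      using le[of "inverse c" "c *\<^sub>C f"] by simp
    then have "cmod c * norm f \<le> norm (c *\<^sub>C f)"
      using False by (simp add: norm_inverse norm_divide field_simps)
    then show ?thesis
      using le[of c f] by simp
  qed
qed

end

instance blinfun :: (real_normed_vector, cbanach) cbanach ..


section \<open>Hilbert bimodules\<close>

text \<open>Completeness of the modules is part of the sort \<^class>\<open>cbanach\<close>.\<close>

locale left_hilbert_module =
  fixes lact :: "'a::cstar_algebra \<Rightarrow> 'v::cbanach \<Rightarrow> 'v"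
    and linner :: "'v \<Rightarrow> 'v \<Rightarrow> 'a"
  assumes lact_add_left: "lact (a + b) x = lact a x + lact b x"
    and lact_add_right: "lact a (x + y) = lact a x + lact a y"
    and lact_scaleC_left: "lact (c *\<^sub>C a) x = c *\<^sub>C lact a x"
    and lact_scaleC_right: "lact a (c *\<^sub>C x) = c *\<^sub>C lact a x"
    and lact_mult: "lact (a * b) x = lact a (lact b x)"
    and linner_add_left: "linner (x + y) z = linner x z + linner y z"
    and linner_scaleC_left: "linner (c *\<^sub>C x) y = c *\<^sub>C linner x y"
    and linner_lact: "linner (lact a x) y = a * linner x y"
    and star_linner: "star (linner x y) = linner y x"
    and positive_linner: "positive (linner x x)"
    and linner_eq_0: "linner x x = 0 \<Longrightarrow> x = 0"
    and norm_linner: "norm x = sqrt (norm (linner x x))"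

locale right_hilbert_module =
  fixes ract :: "'v::cbanach \<Rightarrow> 'b::cstar_algebra \<Rightarrow> 'v"
    and rinner :: "'v \<Rightarrow> 'v \<Rightarrow> 'b"
  assumes ract_add_left: "ract (x + y) b = ract x b + ract y b"
    and ract_add_right: "ract x (b + d) = ract x b + ract x d"
    and ract_scaleC_left: "ract (c *\<^sub>C x) b = c *\<^sub>C ract x b"
    and ract_scaleC_right: "ract x (c *\<^sub>C b) = c *\<^sub>C ract x b"
    and ract_mult: "ract x (b * d) = ract (ract x b) d"
    and rinner_add_right: "rinner x (y + z) = rinner x y + rinner x z"
    and rinner_scaleC_right: "rinner x (c *\<^sub>C y) = c *\<^sub>C rinner x y"
    and rinner_ract: "rinner x (ract y b) = rinner x y * b"
    and star_rinner: "star (rinner x y) = rinner y x"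
    and positive_rinner: "positive (rinner x x)"
    and rinner_eq_0: "rinner x x = 0 \<Longrightarrow> x = 0"
    and norm_rinner: "norm x = sqrt (norm (rinner x x))"

locale hilbert_bimodule =
  left_hilbert_module lact linner + right_hilbert_module ract rinner
  for lact :: "'a::cstar_algebra \<Rightarrow> 'v::cbanach \<Rightarrow> 'v"
    and ract :: "'v \<Rightarrow> 'b::cstar_algebra \<Rightarrow> 'v"
    and linner :: "'v \<Rightarrow> 'v \<Rightarrow> 'a"
    and rinner :: "'v \<Rightarrow> 'v \<Rightarrow> 'b" +
  assumes act_commute: "ract (lact a x) b = lact a (ract x b)"
    and linner_rinner: "lact (linner x y) z = ract x (rinner y z)"


section \<open>Quasi extensions\<close>

text \<open>
  A Banach space is represented by a closed complex subspace of a type of sort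
  \<^class>\<open>cbanach\<close>, with the ambient linear structure and norm; the choice of the whole type
  is allowed. Products and actions are only relevant on the carriers.
\<close>

definition banach_subspace :: "'x::cbanach set \<Rightarrow> bool"
  where "banach_subspace S \<longleftrightarrow> closed S \<and> complex_vector.subspace S"

definition clinear_on :: "'x::cbanach set \<Rightarrow> ('x \<Rightarrow> 'y::cbanach) \<Rightarrow> bool"
  where "clinear_on S f \<longleftrightarrow>
    (\<forall>x\<in>S. \<forall>y\<in>S. f (x + y) = f x + f y) \<and> (\<forall>c. \<forall>x\<in>S. f (c *\<^sub>C x) = c *\<^sub>C f x)"

definition isometric_on :: "'x::cbanach set \<Rightarrow> ('x \<Rightarrow> 'y::cbanach) \<Rightarrow> bool"
  where "isometric_on S f \<longleftrightarrow> (\<forall>x\<in>S. norm (f x) = norm x)"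

definition cbilinear_on ::
  "'x::cbanach set \<Rightarrow> 'y::cbanach set \<Rightarrow> ('x \<Rightarrow> 'y \<Rightarrow> 'z::cbanach) \<Rightarrow> bool"
  where "cbilinear_on S T f \<longleftrightarrow>
    (\<forall>x\<in>S. clinear_on T (f x)) \<and> (\<forall>y\<in>T. clinear_on S (\<lambda>x. f x y))"

definition banach_algebra_on :: "'x::cbanach set \<Rightarrow> ('x \<Rightarrow> 'x \<Rightarrow> 'x) \<Rightarrow> bool"
  where "banach_algebra_on S m \<longleftrightarrow>
    banach_subspace S \<and>
    (\<forall>x\<in>S. \<forall>y\<in>S. m x y \<in> S) \<and>
    cbilinear_on S S m \<and>
    (\<forall>x\<in>S. \<forall>y\<in>S. \<forall>z\<in>S. m (m x y) z = m x (m y z)) \<and>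
    (\<forall>x\<in>S. \<forall>y\<in>S. norm (m x y) \<le> norm x * norm y)"

definition algebra_hom_on ::
  "'x::cbanach set \<Rightarrow> ('x \<Rightarrow> 'x \<Rightarrow> 'x) \<Rightarrow> 'y::cbanach set \<Rightarrow> ('y \<Rightarrow> 'y \<Rightarrow> 'y) \<Rightarrow> ('x \<Rightarrow> 'y) \<Rightarrow> bool"
  where "algebra_hom_on S m T n f \<longleftrightarrow>
    f ` S \<subseteq> T \<and> clinear_on S f \<and> (\<forall>x\<in>S. \<forall>y\<in>S. f (m x y) = n (f x) (f y))"

definition banach_bimodule_on ::
  "'x::cbanach set \<Rightarrow> ('x \<Rightarrow> 'x \<Rightarrow> 'x) \<Rightarrow> 'y::cbanach set \<Rightarrow> ('y \<Rightarrow> 'y \<Rightarrow> 'y) \<Rightarrow>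
    'w::cbanach set \<Rightarrow> ('x \<Rightarrow> 'w \<Rightarrow> 'w) \<Rightarrow> ('w \<Rightarrow> 'y \<Rightarrow> 'w) \<Rightarrow> bool"
  where "banach_bimodule_on S m T n W l r \<longleftrightarrow>
    banach_subspace W \<and>
    (\<forall>a\<in>S. \<forall>w\<in>W. l a w \<in> W) \<and>
    cbilinear_on S W l \<and>
    continuous_on (S \<times> W) (\<lambda>(a, w). l a w) \<and>
    (\<forall>a\<in>S. \<forall>a'\<in>S. \<forall>w\<in>W. l (m a a') w = l a (l a' w)) \<and>
    (\<forall>w\<in>W. \<forall>b\<in>T. r w b \<in> W) \<and>
    cbilinear_on W T r \<and>
    continuous_on (W \<times> T) (\<lambda>(w, b). r w b) \<and>
    (\<forall>w\<in>W. \<forall>b\<in>T. \<forall>b'\<in>T. r w (n b b') = r (r w b) b') \<and>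
    (\<forall>a\<in>S. \<forall>w\<in>W. \<forall>b\<in>T. r (l a w) b = l a (r w b))"

text \<open>
  The data of a quasi extension \<open>(W, \<A>, \<B>, \<Phi>)\<close>. The inclusions \<open>A \<subset> \<A>\<close> and \<open>B \<subset> \<B>\<close> are
  given as maps \<open>inclA\<close> and \<open>inclB\<close>.
\<close>

record ('a, 'b, 'v, 'x, 'y, 'w) quasi_ext =
  algA :: "'x set"
  multA :: "'x \<Rightarrow> 'x \<Rightarrow> 'x"
  inclA :: "'a \<Rightarrow> 'x"
  algB :: "'y set"
  multB :: "'y \<Rightarrow> 'y \<Rightarrow> 'y"
  inclB :: "'b \<Rightarrow> 'y"
  modW :: "'w set"
  actA :: "'x \<Rightarrow> 'w \<Rightarrow> 'w"
  actB :: "'w \<Rightarrow> 'y \<Rightarrow> 'w"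
  embV :: "'v \<Rightarrow> 'w"

definition quasi_extension ::
  "('a::cstar_algebra \<Rightarrow> 'v::cbanach \<Rightarrow> 'v) \<Rightarrow> ('v \<Rightarrow> 'b::cstar_algebra \<Rightarrow> 'v) \<Rightarrow>
    ('a, 'b, 'v, 'x::cbanach, 'y::cbanach, 'w::cbanach) quasi_ext \<Rightarrow> bool"
  where "quasi_extension lact ract E \<longleftrightarrow>
    banach_algebra_on (algA E) (multA E) \<and>
    algebra_hom_on UNIV (*) (algA E) (multA E) (inclA E) \<and>
    isometric_on UNIV (inclA E) \<and>
    (\<forall>a. \<forall>\<alpha>\<in>algA E. multA E (inclA E a) \<alpha> \<in> range (inclA E)) \<and>
    banach_algebra_on (algB E) (multB E) \<and>
    algebra_hom_on UNIV (*) (algB E) (multB E) (inclB E) \<and>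
    isometric_on UNIV (inclB E) \<and>
    (\<forall>b. \<forall>\<beta>\<in>algB E. multB E \<beta> (inclB E b) \<in> range (inclB E)) \<and>
    banach_bimodule_on (algA E) (multA E) (algB E) (multB E) (modW E) (actA E) (actB E) \<and>
    range (embV E) \<subseteq> modW E \<and>
    clinear_on UNIV (embV E) \<and>
    isometric_on UNIV (embV E) \<and>
    (\<forall>a x b. embV E (ract (lact a x) b) =
      actB E (actA E (inclA E a) (embV E x)) (inclB E b)) \<and>
    range (embV E) = closure (complex_vector.span
      {actB E (actA E (inclA E a) w) (inclB E b) | a w b. w \<in> modW E})"

text \<open>
  The suprema below are over nonempty bounded sets, since the product and the actions are
  continuous.
\<close>

definition strictly_essential ::
  "('a::cstar_algebra, 'b::cstar_algebra, 'v::cbanach, 'x::cbanach, 'y::cbanach, 'w::cbanach) quasi_ext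
    \<Rightarrow> bool"
  where "strictly_essential E \<longleftrightarrow>
    (\<forall>\<alpha>\<in>algA E. norm \<alpha> = (SUP a\<in>{a. norm a \<le> 1}. norm (multA E (inclA E a) \<alpha>))) \<and>
    (\<forall>\<beta>\<in>algB E. norm \<beta> = (SUP b\<in>{b. norm b \<le> 1}. norm (multB E \<beta> (inclB E b)))) \<and>
    (\<forall>w\<in>modW E. norm w = (SUP (a, b)\<in>{a. norm a \<le> 1} \<times> {b. norm b \<le> 1}.
      norm (actB E (actA E (inclA E a) w) (inclB E b))))"

definition quasi_ext_embeds ::
  "('a::cstar_algebra, 'b::cstar_algebra, 'v::cbanach, 'x::cbanach, 'y::cbanach, 'w::cbanach) quasi_ext
    \<Rightarrow> ('a, 'b, 'v, 'x1::cbanach, 'y1::cbanach, 'w1::cbanach) quasi_ext \<Rightarrow> bool"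
  where "quasi_ext_embeds E F \<longleftrightarrow> (\<exists>lam mu \<Theta>.
    algebra_hom_on (algA E) (multA E) (algA F) (multA F) lam \<and>
    isometric_on (algA E) lam \<and>
    (\<forall>a. lam (inclA E a) = inclA F a) \<and>
    algebra_hom_on (algB E) (multB E) (algB F) (multB F) mu \<and>
    isometric_on (algB E) mu \<and>
    (\<forall>b. mu (inclB E b) = inclB F b) \<and>
    \<Theta> ` modW E \<subseteq> modW F \<and>
    clinear_on (modW E) \<Theta> \<and>
    isometric_on (modW E) \<Theta> \<and>
    (\<forall>a\<in>algA E. \<forall>w\<in>modW E. \<forall>b\<in>algB E.
      \<Theta> (actB E (actA E a w) b) = actB F (actA F (lam a) (\<Theta> w)) (mu b)) \<and>
    (\<forall>x. \<Theta> (embV E x) = embV F x))"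

text \<open>
  HOL has no quantification over types inside a formula, so the ambient types of the competing
  quasi extensions are a parameter. Maximality proper is this predicate for all \<open>'x\<close>, \<open>'y\<close>
  and \<open>'w\<close>; they are to occur as free type variables in theorems.
\<close>

definition maximal_strictly_essential ::
  "('x::cbanach \<times> 'y::cbanach \<times> 'w::cbanach) itself \<Rightarrow>
    ('a::cstar_algebra \<Rightarrow> 'v::cbanach \<Rightarrow> 'v) \<Rightarrow> ('v \<Rightarrow> 'b::cstar_algebra \<Rightarrow> 'v) \<Rightarrow>
    ('a, 'b, 'v, 'x1::cbanach, 'y1::cbanach, 'w1::cbanach) quasi_ext \<Rightarrow> bool"
  where "maximal_strictly_essential _ lact ract F \<longleftrightarrow>
    quasi_extension lact ract F \<and> strictly_essential F \<and>
    (\<forall>E :: ('a, 'b, 'v, 'x, 'y, 'w) quasi_ext.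
      quasi_extension lact ract E \<and> strictly_essential E \<longrightarrow> quasi_ext_embeds E F)"


section \<open>Multipliers and quasi-multipliers\<close>

definition LM :: "('b::cstar_algebra \<Rightarrow>\<^sub>L 'b) set"
  where "LM = {\<beta> :: 'b \<Rightarrow>\<^sub>L 'b. (\<forall>c b. \<beta> (c *\<^sub>C b) = c *\<^sub>C \<beta> b) \<and> (\<forall>b d. \<beta> (b * d) = \<beta> b * d)}"

definition RM :: "('a::cstar_algebra \<Rightarrow>\<^sub>L 'a) set"
  where "RM = {\<alpha> :: 'a \<Rightarrow>\<^sub>L 'a. (\<forall>c a. \<alpha> (c *\<^sub>C a) = c *\<^sub>C \<alpha> a) \<and> (\<forall>a d. \<alpha> (d * a) = d * \<alpha> a)}"

text \<open>Bilinear maps \<open>A \<times> B \<rightarrow> V\<close> are represented in curried form.\<close>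

definition QM ::
  "('a::cstar_algebra \<Rightarrow> 'v::cbanach \<Rightarrow> 'v) \<Rightarrow> ('v \<Rightarrow> 'b::cstar_algebra \<Rightarrow> 'v) \<Rightarrow>
    ('a \<Rightarrow>\<^sub>L 'b \<Rightarrow>\<^sub>L 'v) set"
  where "QM lact ract = {q :: 'a \<Rightarrow>\<^sub>L 'b \<Rightarrow>\<^sub>L 'v.
    (\<forall>k a b. q (k *\<^sub>C a) b = k *\<^sub>C q a b) \<and>
    (\<forall>k a b. q a (k *\<^sub>C b) = k *\<^sub>C q a b) \<and>
    (\<forall>a b c d. q (c * a) (b * d) = ract (lact c (q a b)) d)}"

definition QM_lact :: "('a::cstar_algebra \<Rightarrow>\<^sub>L 'a) \<Rightarrow> ('a \<Rightarrow>\<^sub>L 'b::cstar_algebra \<Rightarrow>\<^sub>L 'v::cbanach) \<Rightarrow> 'a \<Rightarrow>\<^sub>L 'b \<Rightarrow>\<^sub>L 'v"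
  where "QM_lact \<alpha> q = Blinfun (\<lambda>a. Blinfun (\<lambda>b. q (\<alpha> a) b))"

definition QM_ract :: "('a::cstar_algebra \<Rightarrow>\<^sub>L 'b::cstar_algebra \<Rightarrow>\<^sub>L 'v::cbanach) \<Rightarrow> ('b \<Rightarrow>\<^sub>L 'b) \<Rightarrow> 'a \<Rightarrow>\<^sub>L 'b \<Rightarrow>\<^sub>L 'v"
  where "QM_ract q \<beta> = Blinfun (\<lambda>a. Blinfun (\<lambda>b. q a (\<beta> b)))"

definition Gamma ::
  "('a::cstar_algebra \<Rightarrow> 'v::cbanach \<Rightarrow> 'v) \<Rightarrow> ('v \<Rightarrow> 'b::cstar_algebra \<Rightarrow> 'v) \<Rightarrow>
    'v \<Rightarrow> 'a \<Rightarrow>\<^sub>L 'b \<Rightarrow>\<^sub>L 'v"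
  where "Gamma lact ract x = Blinfun (\<lambda>a. Blinfun (\<lambda>b. ract (lact a x) b))"

text \<open>\<^const>\<open>blinfun_mult_left\<close> and \<^const>\<open>blinfun_mult_right\<close> are \<open>a \<mapsto> (a' \<mapsto> a' a)\<close> and
  \<open>b \<mapsto> (b' \<mapsto> b b')\<close>.\<close>

definition QM_quasi_ext ::
  "('a::cstar_algebra \<Rightarrow> 'v::cbanach \<Rightarrow> 'v) \<Rightarrow> ('v \<Rightarrow> 'b::cstar_algebra \<Rightarrow> 'v) \<Rightarrow>
    ('a, 'b, 'v, 'a \<Rightarrow>\<^sub>L 'a, 'b \<Rightarrow>\<^sub>L 'b, 'a \<Rightarrow>\<^sub>L 'b \<Rightarrow>\<^sub>L 'v) quasi_ext"
  where "QM_quasi_ext lact ract = \<lparr>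
    algA = RM, multA = (\<lambda>\<alpha>\<^sub>1 \<alpha>\<^sub>2. \<alpha>\<^sub>2 o\<^sub>L \<alpha>\<^sub>1), inclA = blinfun_mult_left,
    algB = LM, multB = (o\<^sub>L), inclB = blinfun_mult_right,
    modW = QM lact ract, actA = QM_lact, actB = QM_ract, embV = Gamma lact ract\<rparr>"


subsection \<open>The norm and the values of the maps above are the intended ones\<close>

lemma norm_blinfun_eq_SUP:
  fixes f :: "'x::real_normed_vector \<Rightarrow>\<^sub>L 'y::real_normed_vector"
  shows "norm f = (SUP x\<in>{x. norm x \<le> 1}. norm (f x))"
proof (rule antisym)
  have le: "norm (f x) \<le> norm f" if "norm x \<le> 1" for x
    using norm_blinfun[of f x] mult_left_mono[OF that norm_ge_zero[of f]] by simp
  then have bdd: "bdd_above ((\<lambda>x. norm (f x)) ` {x. norm x \<le> 1})"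
    by (intro bdd_aboveI2[where M = "norm f"]) simp
  have up: "norm (f x) \<le> (SUP x\<in>{x. norm x \<le> 1}. norm (f x))" if "norm x \<le> 1" for x
    using that by (intro cSUP_upper bdd) simp
  show "norm f \<le> (SUP x\<in>{x. norm x \<le> 1}. norm (f x))"
  proof (rule norm_blinfun_bound)
    show "0 \<le> (SUP x\<in>{x. norm x \<le> 1}. norm (f x))"
      using up[of 0] by simp
    fix x
    show "norm (f x) \<le> (SUP x\<in>{x. norm x \<le> 1}. norm (f x)) * norm x"
    proof (cases "x = 0")
      case False
      then have "norm (f (x /\<^sub>R norm x)) \<le> (SUP x\<in>{x. norm x \<le> 1}. norm (f x))"
        by (intro up) simp
      then show ?thesis
        using False by (simp add: blinfun.scaleR_right field_simps)
    qed simp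
  qed
  show "(SUP x\<in>{x. norm x \<le> 1}. norm (f x)) \<le> norm f"
    by (intro cSUP_least) (auto intro: le exI[of _ 0])
qed

lemma norm_QM_eq_SUP:
  fixes q :: "'a::real_normed_vector \<Rightarrow>\<^sub>L 'b::real_normed_vector \<Rightarrow>\<^sub>L 'v::real_normed_vector"
  shows "norm q = (SUP (a, b)\<in>{a. norm a \<le> 1} \<times> {b. norm b \<le> 1}. norm (q a b))"
    (is "_ = (SUP p\<in>?D. ?g p)")
proof (rule antisym)
  have le: "norm (q a b) \<le> norm q" if "norm a \<le> 1" "norm b \<le> 1" for a b
  proof -
    have "norm (q a b) \<le> norm (q a) * norm b"
      by (rule norm_blinfun)
    also have "\<dots> \<le> norm (q a)"
      using mult_left_mono[OF that(2) norm_ge_zero[of "q a"]] by simp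
    also have "\<dots> \<le> norm q * norm a"
      by (rule norm_blinfun)
    also have "\<dots> \<le> norm q"
      using mult_left_mono[OF that(1) norm_ge_zero[of q]] by simp
    finally show ?thesis .
  qed
  then have bdd: "bdd_above (?g ` ?D)"
    by (intro bdd_aboveI2[where M = "norm q"]) auto
  have zero: "(0::'a) \<in> {a. norm a \<le> 1}" "(0::'b) \<in> {b. norm b \<le> 1}"
    by simp_all
  have "norm (q a) \<le> (SUP p\<in>?D. ?g p)" if "norm a \<le> 1" for a
    unfolding norm_blinfun_eq_SUP[of "q a"]
  proof (rule cSUP_least)
    fix b :: 'b
    assume "b \<in> {b. norm b \<le> 1}"
    then show "norm (q a b) \<le> (SUP p\<in>?D. ?g p)"
      using cSUP_upper[OF _ bdd, of "(a, b)"] that by simp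
  qed (use zero in blast)
  then show "norm q \<le> (SUP p\<in>?D. ?g p)"
    unfolding norm_blinfun_eq_SUP[of q] by (intro cSUP_least) (auto intro: exI[of _ 0])
  show "(SUP p\<in>?D. ?g p) \<le> norm q"
    by (intro cSUP_least) (use zero in blast, auto intro: le)
qed

lemma Blinfun_Blinfun_apply:
  assumes "bounded_bilinear f"
  shows "blinfun_apply (blinfun_apply (Blinfun (\<lambda>a. Blinfun (\<lambda>b. f a b))) a) b = f a b"
proof -
  interpret bounded_bilinear f
    by (rule assms)
  have inner: "blinfun_apply (Blinfun (f a)) b = f a b" for a b
    by (simp add: bounded_linear_Blinfun_apply bounded_linear_right)
  obtain K where K: "0 \<le> K" "\<And>a b. norm (f a b) \<le> norm a * norm b * K"
    using nonneg_bounded by blast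
  have "bounded_linear (\<lambda>a. Blinfun (f a))"
  proof (rule bounded_linear_intro[where K = K])
    fix a
    show "norm (Blinfun (f a)) \<le> norm a * K"
      using K by (intro norm_blinfun_bound) (simp_all add: inner mult_ac)
  qed (auto intro!: blinfun_eqI simp: inner add_left scaleR_left blinfun.add_left blinfun.scaleR_left)
  then show ?thesis
    by (simp add: bounded_linear_Blinfun_apply inner)
qed

lemma QM_lact_apply: "QM_lact \<alpha> q a b = q (\<alpha> a) b"
proof -
  have "QM_lact \<alpha> q = q o\<^sub>L \<alpha>"
    by (simp add: QM_lact_def blinfun_compose_def blinfun_apply_inverse comp_def)
  then show ?thesis
    by simp
qed

lemma QM_ract_apply: "QM_ract q \<beta> a b = q a (\<beta> b)"
proof -
  have "bounded_bilinear (\<lambda>a b. q a (\<beta> b))"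
    using bounded_bilinear.comp[OF bounded_bilinear_blinfun_apply
      blinfun.bounded_linear_right[of q] blinfun.bounded_linear_right[of \<beta>]] .
  then show ?thesis
    unfolding QM_ract_def by (rule Blinfun_Blinfun_apply)
qed

lemma norm_star: "norm (star x) = norm (x :: 'a::cstar_algebra)"
proof -
  have le: "norm y \<le> norm (star y)" for y :: 'a
  proof (cases "y = 0")
    case False
    have "norm y * norm y \<le> norm (star y) * norm y"
      using norm_mult_ineq[of "star y" y] by (simp add: norm_star_mult power2_eq_square)
    then show ?thesis
      using False by simp
  qed simp
  show ?thesis
    using le[of x] le[of "star x"] by (simp add: star_star)
qed

context hilbert_bimodule
begin

lemma norm_lact_le: "norm (lact a x) \<le> norm a * norm x"
proof -
  have "linner (lact a x) (lact a x) = a * linner x x * star a"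
    by (subst linner_lact, subst star_linner[symmetric], subst linner_lact)
      (simp add: star_mult star_linner mult.assoc)
  then have "norm (linner (lact a x) (lact a x)) \<le> norm a * norm (linner x x) * norm a"
    using order_trans[OF norm_mult_ineq[of "a * linner x x" "star a"]
        mult_right_mono[OF norm_mult_ineq[of a "linner x x"] norm_ge_zero[of "star a"]]]
    by (simp add: norm_star)
  then have "sqrt (norm (linner (lact a x) (lact a x))) \<le> sqrt ((norm a)\<^sup>2 * norm (linner x x))"
    by (simp add: power2_eq_square mult_ac)
  then show ?thesis
    by (simp add: norm_linner[symmetric] real_sqrt_mult)
qed

lemma norm_ract_le: "norm (ract x b) \<le> norm x * norm b"
proof -
  have "rinner (ract x b) (ract x b) = star b * rinner x x * b"
    by (subst rinner_ract, subst star_rinner[symmetric], subst rinner_ract)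
      (simp add: star_mult star_rinner)
  then have "norm (rinner (ract x b) (ract x b)) \<le> norm b * norm (rinner x x) * norm b"
    using order_trans[OF norm_mult_ineq[of "star b * rinner x x" b]
        mult_right_mono[OF norm_mult_ineq[of "star b" "rinner x x"] norm_ge_zero[of b]]]
    by (simp add: norm_star)
  then have "sqrt (norm (rinner (ract x b) (ract x b))) \<le> sqrt (norm (rinner x x) * (norm b)\<^sup>2)"
    by (simp add: power2_eq_square mult_ac)
  then show ?thesis
    by (simp add: norm_rinner[symmetric] real_sqrt_mult)
qed

lemma Gamma_apply: "Gamma lact ract x a b = ract (lact a x) b"
proof -
  have "bounded_bilinear (\<lambda>a b. ract (lact a x) b)"
  proof
    fix r :: real and a a' :: 'a and b b' :: 'b
    show "ract (lact (a + a') x) b = ract (lact a x) b + ract (lact a' x) b"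
      by (simp add: lact_add_left ract_add_left)
    show "ract (lact a x) (b + b') = ract (lact a x) b + ract (lact a x) b'"
      by (rule ract_add_right)
    show "ract (lact (r *\<^sub>R a) x) b = r *\<^sub>R ract (lact a x) b"
      by (simp add: scaleC_of_real[symmetric] lact_scaleC_left ract_scaleC_left)
    show "ract (lact a x) (r *\<^sub>R b) = r *\<^sub>R ract (lact a x) b"
      by (simp add: scaleC_of_real[symmetric] ract_scaleC_right)
    show "\<exists>K. \<forall>a b. norm (ract (lact a x) b) \<le> norm a * norm b * K"
    proof (intro exI allI)
      fix a :: 'a and b :: 'b
      have "norm (ract (lact a x) b) \<le> norm (lact a x) * norm b"
        by (rule norm_ract_le)
      also have "\<dots> \<le> norm a * norm x * norm b"
        by (intro mult_right_mono norm_lact_le) simp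
      finally show "norm (ract (lact a x) b) \<le> norm a * norm b * norm x"
        by (simp add: mult_ac)
    qed
  qed
  then show ?thesis
    unfolding Gamma_def by (rule Blinfun_Blinfun_apply)
qed

end

end

theory Submission
  imports Defs
begin

text \<open>
  Everything rests on two facts about a Hilbert bimodule \<open>V\<close>: its norm is recovered from the
  two-sided action, \<open>\<parallel>x\<parallel> = \<parallel>a x b\<parallel>\<close> for suitable contractions \<open>a\<close> and \<open>b\<close>
  (\<open>exists_norming_lact\<close>, \<open>exists_norming_ract\<close>), and \<open>V\<close> is nondegenerate, every \<open>x\<close> being a
  limit of elements \<open>a x b\<close> (\<open>in_closure_biaction\<close>). Through the inner products both become
  statements about a self-adjoint element \<open>h\<close> of a \<open>C\<^sup>*\<close>-algebra. The first is
  \<open>\<parallel>h\<^sup>3\<parallel> = \<parallel>h\<parallel>\<^sup>3\<close>. The second asks for an approximate unit for \<open>h\<close>; it is obtained without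
  spectral theory, by applying the mean ergodic argument to the Cayley transform of \<open>h\<close>
  (\<open>exists_approximate_left_unit\<close>).

  Given these facts, \<open>\<Gamma>\<close> is isometric. The identity \<open>a q b = \<Gamma> (q(a, b))\<close> for a
  quasi-multiplier \<open>q\<close> (\<open>QM_sandwich\<close>) puts \<open>A QM(V) B\<close> inside the range of \<open>\<Gamma>\<close>, and
  nondegeneracy gives the other inclusion, because \<open>\<Gamma>(a x b) = a \<Gamma>(x) b\<close>. The same identity
  turns strict essentiality into the definition of the norm of a bounded bilinear map.

  For maximality, let \<open>(W, \<A>, \<B>, \<Phi>)\<close> be a strictly essential quasi extension. Since \<open>A\<close> is a
  right ideal of \<open>\<A>\<close>, each \<open>\<alpha>\<close> in \<open>\<A>\<close> acts on \<open>A\<close> by \<open>a \<mapsto> a \<alpha>\<close>; since \<open>B\<close> is a left ideal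
  of \<open>\<B>\<close>, each \<open>\<beta>\<close> in \<open>\<B>\<close> acts on \<open>B\<close> by \<open>b \<mapsto> \<beta> b\<close>; and since \<open>a w b\<close> lies in the range of
  \<open>\<Phi>\<close>, each \<open>w\<close> in \<open>W\<close> gives the quasi-multiplier \<open>(a, b) \<mapsto> \<Phi>\<inverse>(a w b)\<close>. These three maps
  are the required embeddings: they are isometric because the extension is strictly
  essential, and every algebraic identity is checked after applying the isometric, hence
  injective, map \<open>A \<rightarrow> \<A>\<close>, \<open>B \<rightarrow> \<B>\<close> or \<open>\<Phi>\<close>.
\<close>

section \<open>Approximate units in \<open>C\<^sup>*\<close>-algebras\<close>

lemma star_diff: "star (x - y) = star x - star (y :: 'a::cstar_algebra)"
proof -
  interpret additive "star :: 'a \<Rightarrow> 'a"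
    by standard (rule star_add)
  show ?thesis
    by (rule diff)
qed

lemma star_scaleR: "star (r *\<^sub>R x) = r *\<^sub>R star (x :: 'a::cstar_algebra)"
  by (simp add: scaleC_of_real[symmetric] star_scaleC)

lemma norm_mult_star: "norm (x * star x) = (norm (x :: 'a::cstar_algebra))\<^sup>2"
  using norm_star_mult[of "star x"] by (simp add: star_star norm_star)

text \<open>
  The hypothesis says that \<open>k = (1 - \<i>h)\<inverse> h\<close> in the unitization, so \<open>1 + 2\<i>k\<close> is the Cayley
  transform \<open>(1 + \<i>h) (1 - \<i>h)\<inverse>\<close>. It preserves norms: with \<open>b = (1 - \<i>h)\<inverse> c\<close>, both
  \<open>((1 + \<i>h) b)\<^sup>* ((1 + \<i>h) b)\<close> and \<open>((1 - \<i>h) b)\<^sup>* ((1 - \<i>h) b)\<close> are \<open>b\<^sup>* (1 + h\<^sup>2) b\<close>.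
\<close>

lemma cayley_transform_nonexpansive:
  fixes h k c :: "'a::cstar_algebra"
  assumes sa: "star h = h" and k: "k = h + \<i> *\<^sub>C (h * k)"
  shows "norm (c + (2 * \<i>) *\<^sub>C (k * c)) \<le> norm c"
proof -
  \<comment> \<open>\<open>1 + \<i>k\<close> is the inverse of \<open>1 - \<i>h\<close>.\<close>
  define b where "b = c + \<i> *\<^sub>C (k * c)"
  have kc: "k * c = h * c + \<i> *\<^sub>C (h * (k * c))"
    by (subst k) (simp add: distrib_right mult_scaleC_left mult.assoc)
  have hb: "\<i> *\<^sub>C (h * b) = \<i> *\<^sub>C (k * c)"
    by (subst kc) (simp add: b_def distrib_left mult_scaleC_right)
  have c: "c = b - \<i> *\<^sub>C (h * b)"
    unfolding hb by (simp add: b_def)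
  have "\<i> *\<^sub>C y + \<i> *\<^sub>C y = (2 * \<i>) *\<^sub>C y" for y :: 'a
    by (simp add: scaleC_add_left[symmetric])
  then have u: "c + (2 * \<i>) *\<^sub>C (k * c) = b + \<i> *\<^sub>C (h * b)"
    unfolding hb by (simp add: b_def add.assoc)
  have bh: "star (\<i> *\<^sub>C (h * b)) = - (\<i> *\<^sub>C (star b * h))"
    by (simp add: star_scaleC star_mult sa)
  have *: "\<i> *\<^sub>C \<i> *\<^sub>C y = - y" for y :: 'a
    by (simp add: scaleC_scaleC)
  have "star (b + \<i> *\<^sub>C (h * b)) * (b + \<i> *\<^sub>C (h * b)) = star b * b + star b * (h * (h * b))"
    by (simp add: star_add bh distrib_left distrib_right left_diff_distrib mult_scaleC_left
        mult_scaleC_right mult.assoc complex_vector.scale_right_diff_distrib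
        scaleC_add_right *)
  also have "\<dots> = star (b - \<i> *\<^sub>C (h * b)) * (b - \<i> *\<^sub>C (h * b))"
    by (simp add: star_diff bh distrib_left distrib_right left_diff_distrib right_diff_distrib
        mult_scaleC_left mult_scaleC_right mult.assoc complex_vector.scale_right_diff_distrib
        scaleC_add_right *)
  finally have "(norm (b + \<i> *\<^sub>C (h * b)))\<^sup>2 = (norm (b - \<i> *\<^sub>C (h * b)))\<^sup>2"
    by (simp add: norm_star_mult[symmetric])
  then have "norm (b + \<i> *\<^sub>C (h * b)) = norm (b - \<i> *\<^sub>C (h * b))"
    by simp
  then show ?thesis
    using u c by (metis order_refl)
qed

text \<open>
  Here \<open>1 + w\<close> is the Cayley transform of \<open>h\<close>. Because \<open>w = 2\<i>h (1 - \<i>h)\<inverse>\<close>, the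
  element \<open>w\<close> divides \<open>h\<close> in the unitization; multiplying by \<open>h\<close> once more keeps the cofactor \<open>d\<close> inside the algebra.
\<close>

lemma exists_nonexpansive_shift:
  fixes h :: "'a::cstar_algebra"
  assumes sa: "star h = h" and small: "norm h \<le> 1/2"
  obtains w d where "\<And>c. norm (c + w * c) \<le> norm c" and "w * d = h * h"
proof -
  have half: "norm (h * y) \<le> 1/2 * norm y" for y
    using order_trans[OF norm_mult_ineq mult_right_mono[OF small norm_ge_zero]] .
  \<comment> \<open>The fixed point is the value of the geometric series of \<open>\<i>h\<close>, times \<open>h\<close>.\<close>
  have "\<exists>!k. h + \<i> *\<^sub>C (h * k) = k"
  proof (rule banach_fix_type[where c = "1/2"])
    show "\<forall>x y. dist (h + \<i> *\<^sub>C (h * x)) (h + \<i> *\<^sub>C (h * y)) \<le> 1/2 * dist x y"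
      using half by (auto simp: dist_norm complex_vector.scale_right_diff_distrib[symmetric]
          right_diff_distrib[symmetric] norm_scaleC)
  qed auto
  then obtain k where k: "k = h + \<i> *\<^sub>C (h * k)"
    by metis
  \<comment> \<open>Both products are fixed points of the contraction \<open>y \<mapsto> h\<^sup>2 + \<i>hy\<close>.\<close>
  have comm: "k * h = h * k"
  proof -
    have "k * h = h * h + \<i> *\<^sub>C (h * (k * h))"
      by (subst k) (simp add: distrib_right mult_scaleC_left mult.assoc)
    moreover have "h * k = h * h + \<i> *\<^sub>C (h * (h * k))"
      by (subst k) (simp add: distrib_left mult_scaleC_right)
    ultimately have "k * h - h * k = \<i> *\<^sub>C (h * (k * h - h * k))"
      by (metis add_diff_cancel_left complex_vector.scale_right_diff_distrib right_diff_distrib)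
    then have "norm (k * h - h * k) \<le> 1/2 * norm (k * h - h * k)"
      using half[of "k * h - h * k"] by (metis norm_scaleC norm_ii mult_1)
    then show ?thesis
      by simp
  qed
  have "k * (h - \<i> *\<^sub>C (h * h)) = h * (k - \<i> *\<^sub>C (h * k))"
    by (simp add: right_diff_distrib mult_scaleC_right comm mult.assoc[symmetric])
      (simp add: mult.assoc comm)
  also have "k - \<i> *\<^sub>C (h * k) = h"
    using k by (metis add_diff_cancel_right')
  finally have kh: "k * (h - \<i> *\<^sub>C (h * h)) = h * h" .
  show thesis
  proof (rule that)
    show "norm (c + ((2 * \<i>) *\<^sub>C k) * c) \<le> norm c" for c
      using cayley_transform_nonexpansive[OF sa k] by (simp add: mult_scaleC_left)
    show "((2 * \<i>) *\<^sub>C k) * (inverse (2 * \<i>) *\<^sub>C (h - \<i> *\<^sub>C (h * h))) = h * h"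
      by (simp add: mult_scaleC_left mult_scaleC_right scaleC_scaleC kh)
  qed
qed

text \<open>
  For a contraction \<open>u = 1 + w\<close> the averages \<open>(1 + u + \<dots> + u\<^sup>n\<^sup>-\<^sup>1) / n\<close> are contractions that
  send \<open>w d = u d - d\<close> to \<open>(u\<^sup>n d - d) / n\<close>, which tends to \<open>0\<close>. Each average has the form
  \<open>1 - e\<close> with \<open>e\<close> in the algebra, since each power of \<open>1 + w\<close> has this form.
\<close>

lemma mean_ergodic_element:
  fixes w d :: "'a::cstar_algebra"
  assumes w: "\<And>c. norm (c + w * c) \<le> norm c" and "0 < \<epsilon>"
  obtains e where "\<And>c. norm (c - e * c) \<le> norm c" and "norm (w * d - e * (w * d)) < \<epsilon>"
proof -
  define u where "u c = c + w * c" for c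
  have u_norm: "norm ((u ^^ j) c) \<le> norm c" for j c
    by (induction j) (auto simp: u_def intro: order_trans[OF w])
  have "\<exists>e. \<forall>c. (u ^^ j) c = c - e * c" for j
  proof (induction j)
    case 0
    show ?case
      by (rule exI[of _ 0]) simp
  next
    case (Suc j)
    then obtain e where "\<And>c. (u ^^ j) c = c - e * c"
      by blast
    then have "(u ^^ Suc j) c = c - (e - w + w * e) * c" for c
      by (simp add: u_def left_diff_distrib right_diff_distrib distrib_right mult.assoc)
    then show ?case
      by blast
  qed
  then obtain e where e: "\<And>j c. (u ^^ j) c = c - e j * c"
    by metis
  obtain n :: nat where n: "2 * norm d / \<epsilon> < real n"
    using reals_Archimedean2 by blast
  have "0 \<le> 2 * norm d / \<epsilon>"
    using \<open>0 < \<epsilon>\<close> by simp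
  with n have "0 < n"
    by linarith
  define m where "m = (1 / real n) *\<^sub>R (\<Sum>j<n. e j)"
  have mean: "c - m * c = (1 / real n) *\<^sub>R (\<Sum>j<n. (u ^^ j) c)" for c
  proof -
    have "(\<Sum>j<n. (u ^^ j) c) = real n *\<^sub>R c - (\<Sum>j<n. e j) * c"
      by (simp add: e sum_subtractf sum_distrib_right sum_constant_scaleR)
    then show ?thesis
      using \<open>0 < n\<close> by (simp add: m_def scaleR_right_diff_distrib)
  qed
  show thesis
  proof (rule that)
    fix c
    have "norm (\<Sum>j<n. (u ^^ j) c) \<le> real n * norm c"
      using sum_norm_le[of "{..<n}" "\<lambda>j. (u ^^ j) c" "\<lambda>_. norm c"] u_norm by simp
    then show "norm (c - m * c) \<le> norm c"
      unfolding mean using \<open>0 < n\<close> by (simp add: field_simps)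
  next
    have step: "(u ^^ j) (w * d) = (u ^^ Suc j) d - (u ^^ j) d" for j
    proof -
      have "(u ^^ Suc j) d = (u ^^ j) (d + w * d)"
        by (simp add: funpow_swap1 u_def)
      then show ?thesis
        by (simp add: e algebra_simps)
    qed
    have "(\<Sum>j<n. (u ^^ j) (w * d)) = (u ^^ n) d - d"
      unfolding step by (subst sum_lessThan_telescope) simp
    then have "norm (\<Sum>j<n. (u ^^ j) (w * d)) \<le> 2 * norm d"
      using norm_triangle_ineq4[of "(u ^^ n) d" d] u_norm[of n d] by simp
    also have "\<dots> < \<epsilon> * real n"
      using n \<open>0 < \<epsilon>\<close> by (simp add: field_simps)
    finally show "norm (w * d - m * (w * d)) < \<epsilon>"
      unfolding mean using \<open>0 < n\<close> by (simp add: field_simps)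
  qed
qed

text \<open>
  The mean ergodic argument makes \<open>(1 - e) h\<^sup>2\<close> small. One factor \<open>h\<close> is removed with the
  \<open>C\<^sup>*\<close>-identity: for \<open>g = (1 - e) h\<close>, since \<open>1 - e\<close> acts as a contraction,
  \<open>\<parallel>g\<parallel>\<^sup>2 = \<parallel>g g\<^sup>*\<parallel> = \<parallel>(1 - e) h g\<^sup>*\<parallel> \<le> \<parallel>h g\<^sup>*\<parallel> = \<parallel>g h\<parallel> = \<parallel>(1 - e) h\<^sup>2\<parallel>\<close>.
\<close>

lemma exists_approximate_left_unit:
  fixes h :: "'a::cstar_algebra"
  assumes sa: "star h = h" and "0 < \<epsilon>"
  obtains e where "\<And>c. norm (c - e * c) \<le> norm c" and "norm (h - e * h) < \<epsilon>"
proof -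
  \<comment> \<open>Rescaling brings \<open>h\<close> into the range where the geometric series of \<open>\<i>h\<close> converges.\<close>
  define r where "r = 1 / (2 * (norm h + 1))"
  have pos: "0 < norm h + 1"
    by (simp add: add_nonneg_pos)
  then have r: "0 < r"
    by (simp add: r_def)
  have small: "norm (r *\<^sub>R h) \<le> 1/2"
    using pos by (simp add: r_def field_simps)
  obtain w d where w: "\<And>c. norm (c + w * c) \<le> norm c" and d: "w * d = (r *\<^sub>R h) * (r *\<^sub>R h)"
    using exists_nonexpansive_shift[OF _ small] sa by (metis star_scaleR)
  have "0 < (r * \<epsilon>)\<^sup>2"
    using r \<open>0 < \<epsilon>\<close> by simp
  from mean_ergodic_element[OF w this] obtain e where e: "\<And>c. norm (c - e * c) \<le> norm c"
    and small_sq: "norm (w * d - e * (w * d)) < (r * \<epsilon>)\<^sup>2"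
    by blast
  define g where "g = h - e * h"
  have "(norm g)\<^sup>2 = norm (h * star g - e * (h * star g))"
    by (simp add: norm_mult_star[symmetric] left_diff_distrib mult.assoc g_def)
  also have "\<dots> \<le> norm (h * star g)"
    by (rule e)
  also have "h * star g = star (g * h)"
    by (simp add: star_mult sa)
  also have "norm \<dots> = norm (h * h - e * (h * h))"
    by (simp add: norm_star g_def left_diff_distrib mult.assoc)
  finally have "r\<^sup>2 * (norm g)\<^sup>2 \<le> r\<^sup>2 * norm (h * h - e * (h * h))"
    by (simp add: mult_left_mono)
  also have "\<dots> = norm (w * d - e * (w * d))"
    unfolding d by (simp add: power2_eq_square scaleR_right_diff_distrib[symmetric])
  also note small_sq
  finally have "(r * norm g)\<^sup>2 < (r * \<epsilon>)\<^sup>2"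
    by (simp add: power_mult_distrib)
  then have "r * norm g < r * \<epsilon>"
    by (rule power2_less_imp_less) (use r \<open>0 < \<epsilon>\<close> in simp)
  then have "norm g < \<epsilon>"
    using r by simp
  then show thesis
    using that[of e] e by (simp add: g_def)
qed

text \<open>
  The element is \<open>(1 - e) h (1 - e)\<^sup>*\<close>. For \<open>h\<close> the left inner product of \<open>x\<close> with itself this
  is the one of \<open>x - e x\<close>, and for \<open>h\<close> the right inner product it is the one of \<open>x - x e\<^sup>*\<close>, so
  that one estimate serves both sides.
\<close>

lemma exists_compression_small:
  fixes h :: "'a::cstar_algebra"
  assumes sa: "star h = h" and "0 < \<epsilon>"
  obtains e where "norm (h - e * h - h * star e + e * h * star e) < \<epsilon>"
proof -
  obtain e where e: "\<And>c. norm (c - e * c) \<le> norm c" "norm (h - e * h) < \<epsilon>"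
    using exists_approximate_left_unit[OF assms] by blast
  define g where "g = h - e * h"
  have "h - e * h - h * star e + e * h * star e = star (star g - e * star g)"
    by (simp add: g_def star_diff star_mult star_star left_diff_distrib right_diff_distrib
        mult.assoc)
  then have "norm (h - e * h - h * star e + e * h * star e) \<le> norm (star g)"
    using e(1)[of "star g"] by (simp only: norm_star)
  also have "\<dots> < \<epsilon>"
    using e(2) by (simp add: norm_star g_def)
  finally show thesis
    by (rule that)
qed

text \<open>
  The \<open>C\<^sup>*\<close>-identity gives the exponents \<open>2\<close> and \<open>4\<close>, and submultiplicativity traps the
  exponent \<open>3\<close> between them: \<open>\<parallel>h\<parallel>\<^sup>4 = \<parallel>h\<^sup>4\<parallel> \<le> \<parallel>h\<^sup>3\<parallel> \<parallel>h\<parallel>\<close>.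
\<close>

lemma norm_selfadjoint_cube:
  fixes h :: "'a::cstar_algebra"
  assumes "star h = h"
  shows "norm (h * h * h) = norm h ^ 3"
proof (rule antisym)
  have sq: "norm (h * h) = (norm h)\<^sup>2"
    using norm_star_mult[of h] assms by simp
  show "norm (h * h * h) \<le> norm h ^ 3"
    using norm_mult_ineq[of "h * h" h] by (simp add: sq power2_eq_square power3_eq_cube)
  have "norm h ^ 4 = (norm (h * h))\<^sup>2"
    by (simp add: sq)
  also have "\<dots> = norm (h * h * h * h)"
    using norm_star_mult[of "h * h"] by (simp add: star_mult assms mult.assoc)
  also have "\<dots> \<le> norm (h * h * h) * norm h"
    by (rule norm_mult_ineq)
  finally show "norm h ^ 3 \<le> norm (h * h * h)"
    by (cases "h = 0") (auto simp: numeral_eq_Suc)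
qed

lemma exists_norming_compression:
  fixes h :: "'a::cstar_algebra"
  assumes "star h = h"
  obtains a where "norm a \<le> 1" "star a = a" "norm (a * h * a) = norm h"
proof
  \<comment> \<open>For \<open>h = 0\<close> this is \<open>0\<close>, since division by zero gives zero.\<close>
  define a where "a = (1 / norm h) *\<^sub>R h"
  show "norm a \<le> 1" "star a = a"
    by (simp_all add: a_def star_scaleR assms)
  have "norm (a * h * a) = norm (h * h * h) / (norm h)\<^sup>2"
    by (simp add: a_def power2_eq_square)
  then show "norm (a * h * a) = norm h"
    by (simp add: norm_selfadjoint_cube[OF assms] power2_eq_square power3_eq_cube)
qed


section \<open>Norm and nondegeneracy of Hilbert bimodules\<close>

lemma clinear_on_UNIV_imp_bounded_linear:
  assumes "clinear_on UNIV f" and "\<And>x. norm (f x) \<le> norm x * K"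
  shows "bounded_linear f"
  using assms by (intro bounded_linear_intro[where K = K])
    (auto simp: clinear_on_def scaleC_of_real[symmetric])

context hilbert_bimodule
begin

lemma bounded_linear_lact_right: "bounded_linear (lact a)"
  by (rule clinear_on_UNIV_imp_bounded_linear[where K = "norm a"])
    (simp_all add: clinear_on_def lact_add_right lact_scaleC_right norm_lact_le[of a] mult.commute)

lemma bounded_linear_ract_left: "bounded_linear (\<lambda>x. ract x b)"
  by (rule clinear_on_UNIV_imp_bounded_linear[where K = "norm b"])
    (simp_all add: clinear_on_def ract_add_left ract_scaleC_left norm_ract_le)

lemma linner_lact_right: "linner x (lact a y) = linner x y * star a"
  by (metis linner_lact star_linner star_mult)

lemma rinner_ract_left: "rinner (ract x b) y = star b * rinner x y"
  by (metis rinner_ract star_rinner star_mult)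

lemma linner_diff_self: "linner (x - y) (x - y) = linner x x - linner y x - linner x y + linner y y"
proof -
  have l: "linner (u - v) z = linner u z - linner v z" for u v z
    using linner_add_left[of "u - v" v z] by (simp add: eq_diff_eq)
  have "linner z (u - v) = linner z u - linner z v" for u v z
    by (metis l star_linner star_diff)
  then show ?thesis
    by (simp add: l)
qed

lemma rinner_diff_self: "rinner (x - y) (x - y) = rinner x x - rinner y x - rinner x y + rinner y y"
proof -
  have r: "rinner z (u - v) = rinner z u - rinner z v" for u v z
    using rinner_add_right[of z "u - v" v] by (simp add: eq_diff_eq)
  have "rinner (u - v) z = rinner u z - rinner v z" for u v z
    by (metis r star_rinner star_diff)
  then show ?thesis
    by (simp add: r)
qed

lemma exists_lact_near:
  assumes "0 < \<epsilon>"
  obtains a where "norm (x - lact a x) < \<epsilon>"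
proof -
  have "0 < \<epsilon>\<^sup>2"
    using assms by simp
  then obtain e where
    e: "norm (linner x x - e * linner x x - linner x x * star e + e * linner x x * star e) < \<epsilon>\<^sup>2"
    using exists_compression_small[OF star_linner] by blast
  have "norm (linner (x - lact e x) (x - lact e x)) < \<epsilon>\<^sup>2"
    using e by (simp add: linner_diff_self linner_lact linner_lact_right mult.assoc)
  then have "norm (x - lact e x) < \<epsilon>"
    unfolding norm_linner using assms by (intro real_less_lsqrt) auto
  then show thesis
    by (rule that)
qed

lemma exists_ract_near:
  assumes "0 < \<epsilon>"
  obtains b where "norm (x - ract x b) < \<epsilon>"
proof -
  have "0 < \<epsilon>\<^sup>2"
    using assms by simp
  then obtain e where
    e: "norm (rinner x x - e * rinner x x - rinner x x * star e + e * rinner x x * star e) < \<epsilon>\<^sup>2"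
    using exists_compression_small[OF star_rinner] by blast
  have "norm (rinner (x - ract x (star e)) (x - ract x (star e))) < \<epsilon>\<^sup>2"
    using e by (simp add: rinner_diff_self rinner_ract rinner_ract_left star_star mult.assoc)
  then have "norm (x - ract x (star e)) < \<epsilon>"
    unfolding norm_rinner using assms by (intro real_less_lsqrt) auto
  then show thesis
    by (rule that)
qed

text \<open>
  Nondegeneracy: approximate \<open>x\<close> by \<open>a x\<close> first, and then the element \<open>a x\<close> by \<open>(a x) b\<close>; in
  this order the two errors add up.
\<close>

lemma in_closure_biaction: "x \<in> closure {ract (lact a x) b | a b. True}"
  unfolding closure_approachable
proof (intro allI impI)
  fix \<epsilon> :: real
  assume "0 < \<epsilon>"
  then obtain a where a: "norm (x - lact a x) < \<epsilon> / 2"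
    using exists_lact_near[of "\<epsilon> / 2" x] by auto
  obtain b where b: "norm (lact a x - ract (lact a x) b) < \<epsilon> / 2"
    using exists_ract_near[of "\<epsilon> / 2" "lact a x"] \<open>0 < \<epsilon>\<close> by auto
  have "dist (ract (lact a x) b) x < \<epsilon>"
    using norm_diff_triangle_less[OF a b] by (simp add: dist_norm norm_minus_commute)
  then show "\<exists>y\<in>{ract (lact a x) b | a b. True}. dist y x < \<epsilon>"
    by blast
qed

lemma exists_norming_lact:
  obtains a where "norm a \<le> 1" "norm (lact a x) = norm x"
proof -
  obtain a where "norm a \<le> 1" "star a = a" "norm (a * linner x x * a) = norm (linner x x)"
    using exists_norming_compression[OF star_linner] by blast
  then show thesis
    using that[of a] by (simp add: norm_linner linner_lact linner_lact_right mult.assoc)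
qed

lemma exists_norming_ract:
  obtains b where "norm b \<le> 1" "norm (ract x b) = norm x"
proof -
  obtain b where "norm b \<le> 1" "star b = b" "norm (b * rinner x x * b) = norm (rinner x x)"
    using exists_norming_compression[OF star_rinner] by blast
  then show thesis
    using that[of b] by (simp add: norm_rinner rinner_ract rinner_ract_left mult.assoc)
qed

text \<open>
  A left multiplier norming \<open>x\<close>, followed by a right multiplier norming \<open>a x\<close>, shows that the
  supremum defining the norm of \<open>\<Gamma>(x)\<close> is attained with the value \<open>\<parallel>x\<parallel>\<close>.
\<close>

lemma norm_Gamma: "norm (Gamma lact ract x) = norm x"
proof (rule antisym)
  show "norm (Gamma lact ract x) \<le> norm x"
  proof (intro norm_blinfun_bound)
    fix a b
    have "norm (ract (lact a x) b) \<le> norm (lact a x) * norm b"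
      by (rule norm_ract_le)
    also have "\<dots> \<le> norm x * norm a * norm b"
      using norm_lact_le[of a x] by (intro mult_right_mono) (simp_all add: mult.commute)
    finally show "norm (Gamma lact ract x a b) \<le> norm x * norm a * norm b"
      by (simp add: Gamma_apply)
  qed simp_all
  obtain a where a: "norm a \<le> 1" "norm (lact a x) = norm x"
    by (rule exists_norming_lact)
  obtain b where b: "norm b \<le> 1" "norm (ract (lact a x) b) = norm (lact a x)"
    by (rule exists_norming_ract)
  have "norm x = norm (Gamma lact ract x a b)"
    by (simp add: Gamma_apply a b)
  also have "\<dots> \<le> norm (Gamma lact ract x a) * norm b"
    by (rule norm_blinfun)
  also have "\<dots> \<le> norm (Gamma lact ract x a)"
    using b by (simp add: mult_left_le)
  also have "\<dots> \<le> norm (Gamma lact ract x) * norm a"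
    by (rule norm_blinfun)
  also have "\<dots> \<le> norm (Gamma lact ract x)"
    using a by (simp add: mult_left_le)
  finally show "norm x \<le> norm (Gamma lact ract x)" .
qed

lemma clinear_Gamma: "clinear_on UNIV (Gamma lact ract)"
  by (auto simp: clinear_on_def Gamma_apply blinfun.add_left scaleC_blinfun.rep_eq lact_add_right
      ract_add_left lact_scaleC_right ract_scaleC_left intro!: blinfun_eqI)

lemma bounded_linear_Gamma: "bounded_linear (Gamma lact ract)"
  by (rule clinear_on_UNIV_imp_bounded_linear[OF clinear_Gamma, where K = 1])
    (simp add: norm_Gamma)

end


section \<open>The multiplier algebras and the space of quasi-multipliers\<close>

lemma bounded_linear_scaleC: "bounded_linear (scaleC c :: 'x::cbanach \<Rightarrow> 'x)"
  by (rule clinear_on_UNIV_imp_bounded_linear[where K = "cmod c"])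
    (simp_all add: clinear_on_def scaleC_add_right scaleC_scaleC norm_scaleC mult.commute)

lemma banach_algebra_RM: "banach_algebra_on RM (\<lambda>\<alpha>\<^sub>1 \<alpha>\<^sub>2. \<alpha>\<^sub>2 o\<^sub>L \<alpha>\<^sub>1)"
proof -
  have "closed (RM :: ('a \<Rightarrow>\<^sub>L 'a) set)"
    unfolding RM_def by (intro closed_Collect_conj closed_Collect_all closed_Collect_eq
        continuous_intros bounded_linear.continuous_on[OF bounded_linear_scaleC])
  moreover have "complex_vector.subspace (RM :: ('a \<Rightarrow>\<^sub>L 'a) set)"
    by (simp add: complex_vector.subspace_def RM_def blinfun.add_left scaleC_blinfun.rep_eq
        scaleC_add_right scaleC_scaleC mult.commute distrib_left mult_scaleC_right)
  moreover have "cbilinear_on RM RM (\<lambda>\<alpha>\<^sub>1 \<alpha>\<^sub>2. \<alpha>\<^sub>2 o\<^sub>L \<alpha>\<^sub>1)"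
    by (auto simp: cbilinear_on_def clinear_on_def RM_def blinfun.add_left blinfun.add_right
        scaleC_blinfun.rep_eq intro!: blinfun_eqI)
  moreover have "norm (\<beta> o\<^sub>L \<alpha>) \<le> norm \<alpha> * norm \<beta>" for \<alpha> \<beta> :: "'a \<Rightarrow>\<^sub>L 'a"
    by (simp add: norm_blinfun_compose mult.commute[of "norm \<alpha>"])
  ultimately show ?thesis
    by (simp add: banach_algebra_on_def banach_subspace_def)
      (auto simp: RM_def intro!: blinfun_eqI)
qed

lemma banach_algebra_LM: "banach_algebra_on LM (o\<^sub>L)"
proof -
  have "closed (LM :: ('a \<Rightarrow>\<^sub>L 'a) set)"
    unfolding LM_def by (intro closed_Collect_conj closed_Collect_all closed_Collect_eq
        continuous_intros bounded_linear.continuous_on[OF bounded_linear_scaleC])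
  moreover have "complex_vector.subspace (LM :: ('a \<Rightarrow>\<^sub>L 'a) set)"
    by (simp add: complex_vector.subspace_def LM_def blinfun.add_left scaleC_blinfun.rep_eq
        scaleC_add_right scaleC_scaleC mult.commute distrib_right mult_scaleC_left)
  moreover have "cbilinear_on LM LM (o\<^sub>L)"
    by (auto simp: cbilinear_on_def clinear_on_def LM_def blinfun.add_left blinfun.add_right
        scaleC_blinfun.rep_eq intro!: blinfun_eqI)
  moreover have "norm (\<alpha> o\<^sub>L \<beta>) \<le> norm \<alpha> * norm \<beta>" for \<alpha> \<beta> :: "'a \<Rightarrow>\<^sub>L 'a"
    by (rule norm_blinfun_compose)
  ultimately show ?thesis
    by (simp add: banach_algebra_on_def banach_subspace_def)
      (auto simp: LM_def intro!: blinfun_eqI)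
qed

lemma norm_blinfun_mult_left: "norm (blinfun_mult_left a) = norm (a :: 'a::cstar_algebra)"
proof (rule antisym)
  show "norm (blinfun_mult_left a) \<le> norm a"
    by (rule norm_blinfun_bound) (simp_all add: norm_mult_ineq mult.commute[of "norm a"])
  show "norm a \<le> norm (blinfun_mult_left a)"
    using norm_blinfun[of "blinfun_mult_left a" "star a"]
    by (cases "a = 0") (simp_all add: norm_star_mult norm_star power2_eq_square)
qed

lemma norm_blinfun_mult_right: "norm (blinfun_mult_right b) = norm (b :: 'a::cstar_algebra)"
proof (rule antisym)
  show "norm (blinfun_mult_right b) \<le> norm b"
    by (rule norm_blinfun_bound) (simp_all add: norm_mult_ineq)
  show "norm b \<le> norm (blinfun_mult_right b)"
    using norm_blinfun[of "blinfun_mult_right b" "star b"]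
    by (cases "b = 0") (simp_all add: norm_mult_star norm_star power2_eq_square)
qed

lemma algebra_hom_blinfun_mult_left:
  "algebra_hom_on UNIV (*) RM (\<lambda>\<alpha>\<^sub>1 \<alpha>\<^sub>2. \<alpha>\<^sub>2 o\<^sub>L \<alpha>\<^sub>1) (blinfun_mult_left :: 'a::cstar_algebra \<Rightarrow> _)"
  by (auto simp: algebra_hom_on_def clinear_on_def RM_def mult.assoc mult_scaleC_left
      mult_scaleC_right distrib_left blinfun.add_left scaleC_blinfun.rep_eq intro!: blinfun_eqI)

lemma algebra_hom_blinfun_mult_right:
  "algebra_hom_on UNIV (*) LM (o\<^sub>L) (blinfun_mult_right :: 'a::cstar_algebra \<Rightarrow> _)"
  by (auto simp: algebra_hom_on_def clinear_on_def LM_def mult.assoc mult_scaleC_left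
      mult_scaleC_right distrib_right blinfun.add_left scaleC_blinfun.rep_eq intro!: blinfun_eqI)

text \<open>
  In the opposite multiplication of \<open>RM(A)\<close> the left-hand side is the product \<open>a \<alpha>\<close>: this is
  the right ideal property of \<open>A\<close>, with an explicit value of the product.
\<close>

lemma RM_mult_incl: "\<alpha> \<in> RM \<Longrightarrow> \<alpha> o\<^sub>L blinfun_mult_left a = blinfun_mult_left (\<alpha> a)"
  by (rule blinfun_eqI) (simp add: RM_def)

lemma LM_mult_incl: "\<beta> \<in> LM \<Longrightarrow> \<beta> o\<^sub>L blinfun_mult_right b = blinfun_mult_right (\<beta> b)"
  by (rule blinfun_eqI) (simp add: LM_def)

lemma QM_lact_eq_compose: "QM_lact \<alpha> q = q o\<^sub>L \<alpha>"
  by (intro blinfun_eqI) (simp add: QM_lact_apply)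

lemma continuous_QM_lact: "continuous_on S (\<lambda>(\<alpha>, q). QM_lact \<alpha> q)"
  unfolding QM_lact_eq_compose split_beta by (intro continuous_intros)

lemma bounded_bilinear_QM_ract:
  "bounded_bilinear (QM_ract :: ('a::cstar_algebra \<Rightarrow>\<^sub>L 'b::cstar_algebra \<Rightarrow>\<^sub>L 'c::cbanach) \<Rightarrow> _)"
proof
  have "norm (QM_ract q \<beta>) \<le> norm q * norm \<beta>"
    for q :: "'a \<Rightarrow>\<^sub>L 'b \<Rightarrow>\<^sub>L 'c" and \<beta> :: "'b \<Rightarrow>\<^sub>L 'b"
  proof (intro norm_blinfun_bound)
    fix a b
    have "norm (q a (\<beta> b)) \<le> norm (q a) * norm (\<beta> b)"
      by (rule norm_blinfun)
    also have "\<dots> \<le> (norm q * norm a) * (norm \<beta> * norm b)"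
      by (intro mult_mono norm_blinfun) simp_all
    finally show "norm (QM_ract q \<beta> a b) \<le> norm q * norm \<beta> * norm a * norm b"
      by (simp add: QM_ract_apply mult_ac)
  qed simp_all
  then show "\<exists>K. \<forall>(q :: 'a \<Rightarrow>\<^sub>L 'b \<Rightarrow>\<^sub>L 'c) \<beta>. norm (QM_ract q \<beta>) \<le> norm q * norm \<beta> * K"
    by (intro exI[of _ 1]) simp
qed (auto intro!: blinfun_eqI simp: QM_ract_apply blinfun.add_left blinfun.add_right
    blinfun.scaleR_left blinfun.scaleR_right)

context hilbert_bimodule
begin

lemma Gamma_in_QM: "Gamma lact ract x \<in> QM lact ract"
  by (simp add: QM_def Gamma_apply lact_scaleC_left ract_scaleC_left ract_scaleC_right lact_mult
      ract_mult act_commute)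

lemma banach_subspace_QM: "banach_subspace (QM lact ract)"
proof -
  have "closed (QM lact ract)"
    unfolding QM_def by (intro closed_Collect_conj closed_Collect_all closed_Collect_eq
        continuous_intros bounded_linear.continuous_on[OF bounded_linear_scaleC]
        bounded_linear.continuous_on[OF bounded_linear_lact_right]
        bounded_linear.continuous_on[OF bounded_linear_ract_left])
  moreover have "lact a 0 = 0" "ract 0 b = 0" for a b
    using linear_0 bounded_linear.linear bounded_linear_lact_right bounded_linear_ract_left
    by blast+
  ultimately show ?thesis
    by (auto simp: banach_subspace_def complex_vector.subspace_def QM_def blinfun.add_left
        scaleC_blinfun.rep_eq scaleC_add_right scaleC_scaleC mult.commute lact_add_right
        ract_add_left lact_scaleC_right ract_scaleC_left)
qed

lemma banach_bimodule_QM: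
  "banach_bimodule_on RM (\<lambda>\<alpha>\<^sub>1 \<alpha>\<^sub>2. \<alpha>\<^sub>2 o\<^sub>L \<alpha>\<^sub>1) LM (o\<^sub>L) (QM lact ract) QM_lact QM_ract"
proof -
  have "continuous_on (QM lact ract \<times> LM) (\<lambda>(q, \<beta>). QM_ract q \<beta>)"
    unfolding split_beta
    by (intro bounded_bilinear.continuous_on[OF bounded_bilinear_QM_ract] continuous_intros)
  moreover have "cbilinear_on RM (QM lact ract) QM_lact"
    by (auto simp: cbilinear_on_def clinear_on_def QM_def QM_lact_apply blinfun.add_left
        blinfun.add_right scaleC_blinfun.rep_eq intro!: blinfun_eqI)
  moreover have "cbilinear_on (QM lact ract) LM QM_ract"
    by (auto simp: cbilinear_on_def clinear_on_def QM_def QM_ract_apply blinfun.add_left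
        blinfun.add_right scaleC_blinfun.rep_eq intro!: blinfun_eqI)
  ultimately show ?thesis
    by (simp add: banach_bimodule_on_def banach_subspace_QM continuous_QM_lact)
      (auto simp: QM_def RM_def LM_def QM_lact_apply QM_ract_apply intro!: blinfun_eqI)
qed

text \<open>
  The analogue for quasi-multipliers of the ideal properties of \<open>A\<close> and \<open>B\<close>:
  \<open>(a q b)(a', b') = q(a' a, b b') = a' q(a, b) b'\<close>.
\<close>

lemma QM_sandwich:
  assumes "q \<in> QM lact ract"
  shows "QM_ract (QM_lact (blinfun_mult_left a) q) (blinfun_mult_right b) = Gamma lact ract (q a b)"
  using assms by (intro blinfun_eqI) (simp add: QM_def QM_lact_apply QM_ract_apply Gamma_apply)

text \<open>
  The range is closed because \<open>\<Gamma>\<close> is isometric on a complete space, so it contains the closed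
  span. Conversely \<open>x\<close> is a limit of elements \<open>a x b\<close>, and \<open>\<Gamma>(a x b) = a \<Gamma>(x) b\<close>.
\<close>

lemma range_Gamma:
  "range (Gamma lact ract) = closure (complex_vector.span
    {QM_ract (QM_lact (blinfun_mult_left a) q) (blinfun_mult_right b) | a q b. q \<in> QM lact ract})"
  (is "_ = closure (complex_vector.span ?S)")
proof
  have "complete (range (Gamma lact ract))"
    by (rule complete_isometric_image[where e = 1, OF _ _ bounded_linear_Gamma])
      (simp_all add: norm_Gamma complete_UNIV)
  then have "closed (range (Gamma lact ract))"
    by (rule complete_imp_closed)
  moreover have "complex_vector.span ?S \<subseteq> range (Gamma lact ract)"
  proof (rule complex_vector.span_minimal)
    show "?S \<subseteq> range (Gamma lact ract)"
      using QM_sandwich by auto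
    have add: "Gamma lact ract x + Gamma lact ract y = Gamma lact ract (x + y)"
      and scale: "c *\<^sub>C Gamma lact ract x = Gamma lact ract (c *\<^sub>C x)" for c x y
      using clinear_Gamma by (simp_all add: clinear_on_def)
    have "0 = Gamma lact ract 0"
      using scale[of 0 0] by simp
    then show "complex_vector.subspace (range (Gamma lact ract))"
      unfolding complex_vector.subspace_def by (auto simp: add scale intro: range_eqI)
  qed
  ultimately show "closure (complex_vector.span ?S) \<subseteq> range (Gamma lact ract)"
    by (simp add: closure_minimal)
  show "range (Gamma lact ract) \<subseteq> closure (complex_vector.span ?S)"
  proof
    fix q
    assume "q \<in> range (Gamma lact ract)"
    then obtain x where x: "q = Gamma lact ract x"
      by blast
    have "q \<in> closure (Gamma lact ract ` {ract (lact a x) b | a b. True})"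
      using closure_bounded_linear_image_subset[OF bounded_linear_Gamma] in_closure_biaction[of x]
      by (auto simp: x)
    also have "Gamma lact ract ` {ract (lact a x) b | a b. True} \<subseteq> ?S"
    proof -
      have "Gamma lact ract (ract (lact a x) b) =
          QM_ract (QM_lact (blinfun_mult_left a) (Gamma lact ract x)) (blinfun_mult_right b)" for a b
        using QM_sandwich[OF Gamma_in_QM] by (simp add: Gamma_apply)
      then show ?thesis
        using Gamma_in_QM by blast
    qed
    finally (closure_mono[THEN subsetD, rotated]) show "q \<in> closure (complex_vector.span ?S)"
      using closure_mono[OF complex_vector.span_superset] by blast
  qed
qed

lemma quasi_extension_QM: "quasi_extension lact ract (QM_quasi_ext lact ract)"
proof -
  have "Gamma lact ract (ract (lact a x) b) =
      QM_ract (QM_lact (blinfun_mult_left a) (Gamma lact ract x)) (blinfun_mult_right b)" for a x b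
    using QM_sandwich[OF Gamma_in_QM] by (simp add: Gamma_apply)
  moreover have "range (Gamma lact ract) \<subseteq> QM lact ract"
    using Gamma_in_QM by blast
  moreover have "isometric_on UNIV (blinfun_mult_left :: 'a \<Rightarrow> _)"
    "isometric_on UNIV (blinfun_mult_right :: 'b \<Rightarrow> _)" "isometric_on UNIV (Gamma lact ract)"
    by (simp_all add: isometric_on_def norm_blinfun_mult_left norm_blinfun_mult_right norm_Gamma)
  moreover have "\<alpha> o\<^sub>L blinfun_mult_left a \<in> range blinfun_mult_left" if "\<alpha> \<in> RM" for \<alpha> and a :: 'a
    using RM_mult_incl[OF that] by blast
  moreover have "\<beta> o\<^sub>L blinfun_mult_right b \<in> range blinfun_mult_right" if "\<beta> \<in> LM" for \<beta> and b :: 'b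
    using LM_mult_incl[OF that] by blast
  ultimately show ?thesis
    unfolding quasi_extension_def QM_quasi_ext_def quasi_ext.simps
    by (intro conjI allI ballI banach_algebra_RM banach_algebra_LM algebra_hom_blinfun_mult_left
        algebra_hom_blinfun_mult_right banach_bimodule_QM clinear_Gamma range_Gamma)
qed

lemma strictly_essential_QM: "strictly_essential (QM_quasi_ext lact ract)"
  unfolding strictly_essential_def QM_quasi_ext_def quasi_ext.simps
proof (intro conjI ballI)
  show "norm \<alpha> = (SUP a\<in>{a. norm a \<le> 1}. norm (\<alpha> o\<^sub>L blinfun_mult_left a))"
    if "\<alpha> \<in> RM" for \<alpha> :: "'a \<Rightarrow>\<^sub>L 'a"
    unfolding RM_mult_incl[OF that] norm_blinfun_mult_left by (rule norm_blinfun_eq_SUP)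
  show "norm \<beta> = (SUP b\<in>{b. norm b \<le> 1}. norm (\<beta> o\<^sub>L blinfun_mult_right b))"
    if "\<beta> \<in> LM" for \<beta> :: "'b \<Rightarrow>\<^sub>L 'b"
    unfolding LM_mult_incl[OF that] norm_blinfun_mult_right by (rule norm_blinfun_eq_SUP)
  show "norm q = (SUP (a, b)\<in>{a. norm a \<le> 1} \<times> {b. norm b \<le> 1}.
      norm (QM_ract (QM_lact (blinfun_mult_left a) q) (blinfun_mult_right b)))"
    if "q \<in> QM lact ract" for q
    unfolding QM_sandwich[OF that] norm_Gamma by (rule norm_QM_eq_SUP)
qed

end


section \<open>Embedding a strictly essential quasi extension\<close>

text \<open>
  Joint continuity at the origin gives \<open>\<delta> > 0\<close> such that \<open>f\<close> has norm below \<open>1\<close> on pairs closer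
  than \<open>\<delta>\<close> to it, and every pair of nonzero vectors can be scaled to norms \<open>\<delta>/3\<close>. This bounds
  the actions on a Banach bimodule, of which only norm continuity is assumed.
\<close>

lemma cbilinear_on_bounded:
  fixes f :: "'x::cbanach \<Rightarrow> 'y::cbanach \<Rightarrow> 'z::cbanach"
  assumes S: "banach_subspace S" and T: "banach_subspace T"
    and f: "cbilinear_on S T f" and cont: "continuous_on (S \<times> T) (\<lambda>(x, y). f x y)"
  obtains K where "0 \<le> K" "\<And>x y. x \<in> S \<Longrightarrow> y \<in> T \<Longrightarrow> norm (f x y) \<le> K * norm x * norm y"
proof -
  have zero: "0 \<in> S" "0 \<in> T" and scS: "\<And>r x. x \<in> S \<Longrightarrow> r *\<^sub>R x \<in> S"
    and scT: "\<And>r y. y \<in> T \<Longrightarrow> r *\<^sub>R y \<in> T"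
    using S T by (auto simp: banach_subspace_def complex_vector.subspace_def
        scaleC_of_real[symmetric])
  have fl: "f (r *\<^sub>R x) y = r *\<^sub>R f x y" and fr: "f x (r *\<^sub>R y) = r *\<^sub>R f x y"
    if "x \<in> S" "y \<in> T" for r x y
    using f that by (auto simp: cbilinear_on_def clinear_on_def scaleC_of_real[symmetric])
  have f0: "f 0 y = 0" "f x 0 = 0" if "x \<in> S" "y \<in> T" for x y
    using fl[of 0 y 0] fr[of x 0 0] zero that by simp_all
  obtain \<delta> where \<delta>: "0 < \<delta>"
    and bound: "\<And>x y. x \<in> S \<Longrightarrow> y \<in> T \<Longrightarrow> dist (x, y) (0, 0) < \<delta> \<Longrightarrow> norm (f x y) < 1"
    using cont[unfolded continuous_on_iff, rule_format, of "(0, 0)" 1] zero f0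
    by (force simp: dist_norm)
  have "norm (f x y) \<le> (3 / \<delta>)\<^sup>2 * norm x * norm y" if xy: "x \<in> S" "y \<in> T" for x y
  proof (cases "x = 0 \<or> y = 0")
    case False
    define s where "s = \<delta> / (3 * norm x)"
    define t where "t = \<delta> / (3 * norm y)"
    have pos: "0 < s" "0 < t"
      using False \<delta> by (simp_all add: s_def t_def)
    have "dist (s *\<^sub>R x, t *\<^sub>R y) (0, 0) \<le> norm (s *\<^sub>R x) + norm (t *\<^sub>R y)"
      using norm_Pair_le[of "s *\<^sub>R x" "t *\<^sub>R y"] by (simp add: dist_norm)
    also have "\<dots> < \<delta>"
      using False \<delta> by (simp add: s_def t_def)
    finally have "norm (f (s *\<^sub>R x) (t *\<^sub>R y)) < 1"
      using xy by (intro bound scS scT)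
    then have "s * t * norm (f x y) < 1"
      using xy pos by (simp add: fl fr scS scT mult_ac)
    then show ?thesis
      using False \<delta> by (simp add: s_def t_def field_simps power2_eq_square)
  qed (use xy f0 in auto)
  then show thesis
    using that[of "(3 / \<delta>)\<^sup>2"] by simp
qed

lemma isometric_clinear_inj:
  assumes "clinear_on UNIV j" and "isometric_on UNIV j"
  shows "inj j"
proof (rule injI)
  fix x y
  assume "j x = j y"
  moreover have "j (x + (- 1) *\<^sub>C y) = j x + (- 1) *\<^sub>C j y"
    using assms(1) unfolding clinear_on_def by (metis UNIV_I)
  ultimately have "j (x - y) = 0"
    by simp
  then show "x = y"
    using assms(2) by (metis isometric_on_def UNIV_I norm_eq_zero right_minus_eq)
qed

text \<open>
  The embeddings into the multiplier spaces all arise by pulling a linear map with values in the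
  range of an isometry \<open>j\<close> back along \<open>j\<close>.
\<close>

lemma clinear_inv_isometric:
  assumes j: "clinear_on UNIV j" "isometric_on UNIV j"
    and f: "clinear_on UNIV f" "\<And>x. f x \<in> range j"
  shows "clinear_on UNIV (\<lambda>x. inv j (f x))"
proof -
  have jinv: "j (inv j (f x)) = f x" for x
    using f(2) by (rule f_inv_into_f)
  have "j (inv j (f (x + y))) = j (inv j (f x) + inv j (f y))"
    "j (inv j (f (c *\<^sub>C x))) = j (c *\<^sub>C inv j (f x))" for x y c
    using j(1) f(1) unfolding jinv clinear_on_def by (metis UNIV_I jinv)+
  then show ?thesis
    using injD[OF isometric_clinear_inj[OF j]] unfolding clinear_on_def by blast
qed

lemma norm_inv_isometric:
  assumes "isometric_on UNIV j" "y \<in> range j"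
  shows "norm (inv j y) = norm y"
  using assms by (metis UNIV_I f_inv_into_f isometric_on_def)

locale strictly_essential_extension = hilbert_bimodule lact ract linner rinner
  for lact :: "'a::cstar_algebra \<Rightarrow> 'v::cbanach \<Rightarrow> 'v"
    and ract :: "'v \<Rightarrow> 'b::cstar_algebra \<Rightarrow> 'v"
    and linner :: "'v \<Rightarrow> 'v \<Rightarrow> 'a"
    and rinner :: "'v \<Rightarrow> 'v \<Rightarrow> 'b" +
  fixes E :: "('a, 'b, 'v, 'x::cbanach, 'y::cbanach, 'w::cbanach) quasi_ext"
  assumes quasi_ext: "quasi_extension lact ract E"
    and ess: "strictly_essential E"
begin

lemma algA: "banach_algebra_on (algA E) (multA E)"
  and homA: "algebra_hom_on UNIV (*) (algA E) (multA E) (inclA E)"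
  and isoA: "isometric_on UNIV (inclA E)"
  and algB: "banach_algebra_on (algB E) (multB E)"
  and homB: "algebra_hom_on UNIV (*) (algB E) (multB E) (inclB E)"
  and isoB: "isometric_on UNIV (inclB E)"
  and bimod: "banach_bimodule_on (algA E) (multA E) (algB E) (multB E) (modW E) (actA E) (actB E)"
  and isoV: "isometric_on UNIV (embV E)"
  and clinearV: "clinear_on UNIV (embV E)"
  and embV_act: "embV E (ract (lact a x) b) = actB E (actA E (inclA E a) (embV E x)) (inclB E b)"
  and embV_in: "embV E x \<in> modW E"
  and idealA: "\<alpha> \<in> algA E \<Longrightarrow> multA E (inclA E a) \<alpha> \<in> range (inclA E)"
  and idealB: "\<beta> \<in> algB E \<Longrightarrow> multB E \<beta> (inclB E b) \<in> range (inclB E)"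
  using quasi_ext unfolding quasi_extension_def by blast+

lemma clinearA: "clinear_on UNIV (inclA E)" and clinearB: "clinear_on UNIV (inclB E)"
  and inclA_in: "inclA E a \<in> algA E" and inclB_in: "inclB E b \<in> algB E"
  and inclA_mult: "inclA E (a * a') = multA E (inclA E a) (inclA E a')"
  and inclB_mult: "inclB E (b * b') = multB E (inclB E b) (inclB E b')"
  using homA homB unfolding algebra_hom_on_def by blast+

lemma actA_in: "\<alpha> \<in> algA E \<Longrightarrow> w \<in> modW E \<Longrightarrow> actA E \<alpha> w \<in> modW E"
  and actB_in: "w \<in> modW E \<Longrightarrow> \<beta> \<in> algB E \<Longrightarrow> actB E w \<beta> \<in> modW E"
  and actA_mult: "\<alpha> \<in> algA E \<Longrightarrow> \<alpha>' \<in> algA E \<Longrightarrow> w \<in> modW E \<Longrightarrow>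
    actA E (multA E \<alpha> \<alpha>') w = actA E \<alpha> (actA E \<alpha>' w)"
  and actB_mult: "w \<in> modW E \<Longrightarrow> \<beta> \<in> algB E \<Longrightarrow> \<beta>' \<in> algB E \<Longrightarrow>
    actB E w (multB E \<beta> \<beta>') = actB E (actB E w \<beta>) \<beta>'"
  and act_comm: "\<alpha> \<in> algA E \<Longrightarrow> w \<in> modW E \<Longrightarrow> \<beta> \<in> algB E \<Longrightarrow>
    actB E (actA E \<alpha> w) \<beta> = actA E \<alpha> (actB E w \<beta>)"
  and cbilinear_actA: "cbilinear_on (algA E) (modW E) (actA E)"
  and cbilinear_actB: "cbilinear_on (modW E) (algB E) (actB E)"
  using bimod unfolding banach_bimodule_on_def by blast+

definition sandwich :: "'w \<Rightarrow> 'a \<Rightarrow> 'b \<Rightarrow> 'w"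
  where "sandwich w a b = actB E (actA E (inclA E a) w) (inclB E b)"

lemma sandwich_in_range: "w \<in> modW E \<Longrightarrow> sandwich w a b \<in> range (embV E)"
proof -
  assume "w \<in> modW E"
  then have "sandwich w a b \<in>
      {actB E (actA E (inclA E a) w) (inclB E b) | a w b. w \<in> modW E}"
    unfolding sandwich_def by blast
  moreover have "range (embV E) = closure (complex_vector.span
      {actB E (actA E (inclA E a) w) (inclB E b) | a w b. w \<in> modW E})"
    using quasi_ext unfolding quasi_extension_def by blast
  ultimately show ?thesis
    using closure_subset complex_vector.span_superset by (metis (no_types, lifting) subsetD)
qed

text \<open>
  The embeddings of \<open>\<A>\<close>, \<open>\<B>\<close> and \<open>W\<close>. The values have the intended meaning on the carriers of
  \<open>E\<close> only; there the maps under \<open>Blinfun\<close> are bounded and the arguments of the inverses lie in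
  the respective ranges.
\<close>

definition repA :: "'x \<Rightarrow> 'a \<Rightarrow>\<^sub>L 'a"
  where "repA \<alpha> = Blinfun (\<lambda>a. inv (inclA E) (multA E (inclA E a) \<alpha>))"

definition repB :: "'y \<Rightarrow> 'b \<Rightarrow>\<^sub>L 'b"
  where "repB \<beta> = Blinfun (\<lambda>b. inv (inclB E) (multB E \<beta> (inclB E b)))"

definition repW :: "'w \<Rightarrow> 'a \<Rightarrow>\<^sub>L 'b \<Rightarrow>\<^sub>L 'v"
  where "repW w = Blinfun (\<lambda>a. Blinfun (\<lambda>b. inv (embV E) (sandwich w a b)))"

lemma inclA_repA:
  assumes \<alpha>: "\<alpha> \<in> algA E"
  shows "inclA E (repA \<alpha> a) = multA E (inclA E a) \<alpha>"
proof -
  let ?f = "\<lambda>a. multA E (inclA E a) \<alpha>"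
  have "clinear_on UNIV ?f"
    using algA clinearA inclA_in \<alpha>
    by (auto simp: banach_algebra_on_def cbilinear_on_def clinear_on_def)
  then have "clinear_on UNIV (\<lambda>a. inv (inclA E) (?f a))"
    using idealA[OF \<alpha>] by (intro clinear_inv_isometric clinearA isoA)
  moreover have "norm (inv (inclA E) (?f a)) \<le> norm a * norm \<alpha>" for a
  proof -
    have "norm (?f a) \<le> norm (inclA E a) * norm \<alpha>"
      using algA inclA_in \<alpha> unfolding banach_algebra_on_def by blast
    then show ?thesis
      using isoA by (simp add: norm_inv_isometric idealA[OF \<alpha>] isometric_on_def)
  qed
  ultimately have "bounded_linear (\<lambda>a. inv (inclA E) (?f a))"
    by (rule clinear_on_UNIV_imp_bounded_linear)
  then have "repA \<alpha> a = inv (inclA E) (?f a)"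
    by (simp add: repA_def bounded_linear_Blinfun_apply)
  then show ?thesis
    using idealA[OF \<alpha>] by (simp add: f_inv_into_f)
qed

lemma inclB_repB:
  assumes \<beta>: "\<beta> \<in> algB E"
  shows "inclB E (repB \<beta> b) = multB E \<beta> (inclB E b)"
proof -
  let ?f = "\<lambda>b. multB E \<beta> (inclB E b)"
  have "clinear_on UNIV ?f"
    using algB clinearB inclB_in \<beta>
    by (auto simp: banach_algebra_on_def cbilinear_on_def clinear_on_def)
  then have "clinear_on UNIV (\<lambda>b. inv (inclB E) (?f b))"
    using idealB[OF \<beta>] by (intro clinear_inv_isometric clinearB isoB)
  moreover have "norm (inv (inclB E) (?f b)) \<le> norm b * norm \<beta>" for b
  proof -
    have "norm (?f b) \<le> norm \<beta> * norm (inclB E b)"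
      using algB inclB_in \<beta> unfolding banach_algebra_on_def by blast
    then show ?thesis
      using isoB by (simp add: norm_inv_isometric idealB[OF \<beta>] isometric_on_def mult.commute)
  qed
  ultimately have "bounded_linear (\<lambda>b. inv (inclB E) (?f b))"
    by (rule clinear_on_UNIV_imp_bounded_linear)
  then have "repB \<beta> b = inv (inclB E) (?f b)"
    by (simp add: repB_def bounded_linear_Blinfun_apply)
  then show ?thesis
    using idealB[OF \<beta>] by (simp add: f_inv_into_f)
qed

lemma sandwich_clinear:
  assumes "w \<in> modW E"
  shows "clinear_on UNIV (\<lambda>a. sandwich w a b)" and "clinear_on UNIV (sandwich w a)"
  using cbilinear_actA cbilinear_actB assms inclA_in inclB_in clinearA clinearB actA_in
  by (simp_all add: sandwich_def cbilinear_on_def clinear_on_def)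

lemma sandwich_clinear_middle: "clinear_on (modW E) (\<lambda>w. sandwich w a b)"
  using cbilinear_actA cbilinear_actB inclA_in inclB_in actA_in
  by (simp add: sandwich_def cbilinear_on_def clinear_on_def)

lemma sandwich_bounded:
  assumes "w \<in> modW E"
  obtains K where "\<And>a b. norm (sandwich w a b) \<le> norm a * norm b * K"
proof -
  have sub: "banach_subspace (algA E)" "banach_subspace (algB E)" "banach_subspace (modW E)"
    and cont: "continuous_on (algA E \<times> modW E) (\<lambda>(a, w). actA E a w)"
      "continuous_on (modW E \<times> algB E) (\<lambda>(w, b). actB E w b)"
    using algA algB bimod unfolding banach_algebra_on_def banach_bimodule_on_def by blast+
  obtain K where K: "0 \<le> K"
    "\<And>\<alpha> w. \<alpha> \<in> algA E \<Longrightarrow> w \<in> modW E \<Longrightarrow> norm (actA E \<alpha> w) \<le> K * norm \<alpha> * norm w"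
    using cbilinear_on_bounded[OF sub(1,3) cbilinear_actA cont(1)] by blast
  obtain L where L: "0 \<le> L"
    "\<And>w \<beta>. w \<in> modW E \<Longrightarrow> \<beta> \<in> algB E \<Longrightarrow> norm (actB E w \<beta>) \<le> L * norm w * norm \<beta>"
    using cbilinear_on_bounded[OF sub(3,2) cbilinear_actB cont(2)] by blast
  have "norm (sandwich w a b) \<le> norm a * norm b * (L * K * norm w)" for a b
  proof -
    have "norm (sandwich w a b) \<le> L * norm (actA E (inclA E a) w) * norm (inclB E b)"
      unfolding sandwich_def by (intro L actA_in inclA_in inclB_in assms)
    also have "\<dots> \<le> L * (K * norm (inclA E a) * norm w) * norm (inclB E b)"
      using L(1) by (intro mult_right_mono mult_left_mono K inclA_in assms) auto
    finally show ?thesis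
      using isoA isoB by (simp add: isometric_on_def mult_ac)
  qed
  then show thesis
    by (rule that)
qed

lemma embV_repW:
  assumes w: "w \<in> modW E"
  shows "embV E (repW w a b) = sandwich w a b"
proof -
  let ?g = "\<lambda>a b. inv (embV E) (sandwich w a b)"
  have lin: "clinear_on UNIV (\<lambda>a. ?g a b)" "clinear_on UNIV (?g a)" for a b
    by (intro clinear_inv_isometric clinearV isoV sandwich_clinear sandwich_in_range w)+
  obtain K where "\<And>a b. norm (sandwich w a b) \<le> norm a * norm b * K"
    using sandwich_bounded[OF w] by blast
  then have K: "norm (?g a b) \<le> norm a * norm b * K" for a b
    by (simp add: norm_inv_isometric isoV sandwich_in_range w)
  have "bounded_bilinear ?g"
    by standard
      (use lin K in \<open>auto simp: clinear_on_def scaleC_of_real[symmetric] intro!: exI[of _ K]\<close>)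
  then have "repW w a b = ?g a b"
    unfolding repW_def by (rule Blinfun_Blinfun_apply)
  then show ?thesis
    using sandwich_in_range[OF w] by (simp add: f_inv_into_f)
qed

lemmas inclA_eqD = injD[OF isometric_clinear_inj[OF clinearA isoA]]
  and inclB_eqD = injD[OF isometric_clinear_inj[OF clinearB isoB]]
  and embV_eqD = injD[OF isometric_clinear_inj[OF clinearV isoV]]

lemma repA_hom: "algebra_hom_on (algA E) (multA E) RM (\<lambda>\<alpha>\<^sub>1 \<alpha>\<^sub>2. \<alpha>\<^sub>2 o\<^sub>L \<alpha>\<^sub>1) repA"
proof -
  have closed: "\<alpha> + \<alpha>' \<in> algA E" "c *\<^sub>C \<alpha> \<in> algA E" "multA E \<alpha> \<alpha>' \<in> algA E"
    and assoc: "\<alpha>'' \<in> algA E \<Longrightarrow> multA E (multA E \<alpha> \<alpha>') \<alpha>'' = multA E \<alpha> (multA E \<alpha>' \<alpha>'')"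
    and add: "\<alpha>'' \<in> algA E \<Longrightarrow> multA E \<alpha>'' (\<alpha> + \<alpha>') = multA E \<alpha>'' \<alpha> + multA E \<alpha>'' \<alpha>'"
    and scale: "multA E \<alpha>' (c *\<^sub>C \<alpha>) = c *\<^sub>C multA E \<alpha>' \<alpha>" "multA E (c *\<^sub>C \<alpha>') \<alpha> = c *\<^sub>C multA E \<alpha>' \<alpha>"
    if "\<alpha> \<in> algA E" "\<alpha>' \<in> algA E" for \<alpha> \<alpha>' \<alpha>'' c
    using algA that by (simp_all add: banach_algebra_on_def banach_subspace_def
      complex_vector.subspace_def cbilinear_on_def clinear_on_def)
  note incl = clinearA[unfolded clinear_on_def, simplified]
  have "repA \<alpha> \<in> RM" if "\<alpha> \<in> algA E" for \<alpha>
    using that unfolding RM_def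
    by (auto intro!: inclA_eqD simp: inclA_repA incl scale inclA_mult assoc inclA_in)
  moreover have "repA (\<alpha> + \<alpha>') = repA \<alpha> + repA \<alpha>'" "repA (c *\<^sub>C \<alpha>) = c *\<^sub>C repA \<alpha>"
    "repA (multA E \<alpha> \<alpha>') = repA \<alpha>' o\<^sub>L repA \<alpha>" if "\<alpha> \<in> algA E" "\<alpha>' \<in> algA E" for \<alpha> \<alpha>' c
    using that by (auto intro!: blinfun_eqI inclA_eqD simp: inclA_repA closed incl add scale assoc
        inclA_in blinfun.add_left scaleC_blinfun.rep_eq)
  ultimately show ?thesis
    unfolding algebra_hom_on_def clinear_on_def by blast
qed

lemma repB_hom: "algebra_hom_on (algB E) (multB E) LM (o\<^sub>L) repB"
proof -
  have closed: "\<beta> + \<beta>' \<in> algB E" "c *\<^sub>C \<beta> \<in> algB E" "multB E \<beta> \<beta>' \<in> algB E"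
    and assoc: "\<beta>'' \<in> algB E \<Longrightarrow> multB E (multB E \<beta> \<beta>') \<beta>'' = multB E \<beta> (multB E \<beta>' \<beta>'')"
    and add: "\<beta>'' \<in> algB E \<Longrightarrow> multB E (\<beta> + \<beta>') \<beta>'' = multB E \<beta> \<beta>'' + multB E \<beta>' \<beta>''"
    and scale: "multB E \<beta>' (c *\<^sub>C \<beta>) = c *\<^sub>C multB E \<beta>' \<beta>" "multB E (c *\<^sub>C \<beta>') \<beta> = c *\<^sub>C multB E \<beta>' \<beta>"
    if "\<beta> \<in> algB E" "\<beta>' \<in> algB E" for \<beta> \<beta>' \<beta>'' c
    using algB that by (simp_all add: banach_algebra_on_def banach_subspace_def
      complex_vector.subspace_def cbilinear_on_def clinear_on_def)
  note incl = clinearB[unfolded clinear_on_def, simplified]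
  have "repB \<beta> \<in> LM" if "\<beta> \<in> algB E" for \<beta>
    using that unfolding LM_def
    by (auto intro!: inclB_eqD simp: inclB_repB incl scale inclB_mult assoc inclB_in)
  moreover have "repB (\<beta> + \<beta>') = repB \<beta> + repB \<beta>'" "repB (c *\<^sub>C \<beta>) = c *\<^sub>C repB \<beta>"
    "repB (multB E \<beta> \<beta>') = repB \<beta> o\<^sub>L repB \<beta>'" if "\<beta> \<in> algB E" "\<beta>' \<in> algB E" for \<beta> \<beta>' c
    using that by (auto intro!: blinfun_eqI inclB_eqD simp: inclB_repB closed incl add scale assoc
        inclB_in blinfun.add_left scaleC_blinfun.rep_eq)
  ultimately show ?thesis
    unfolding algebra_hom_on_def clinear_on_def by blast
qed

lemma repA_isometric: "isometric_on (algA E) repA"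
  unfolding isometric_on_def
proof
  fix \<alpha>
  assume \<alpha>: "\<alpha> \<in> algA E"
  have "norm (repA \<alpha> a) = norm (multA E (inclA E a) \<alpha>)" for a
    using isoA by (simp add: inclA_repA[OF \<alpha>, symmetric] isometric_on_def)
  then show "norm (repA \<alpha>) = norm \<alpha>"
    using ess \<alpha> by (simp add: norm_blinfun_eq_SUP strictly_essential_def)
qed

lemma repB_isometric: "isometric_on (algB E) repB"
  unfolding isometric_on_def
proof
  fix \<beta>
  assume \<beta>: "\<beta> \<in> algB E"
  have "norm (repB \<beta> b) = norm (multB E \<beta> (inclB E b))" for b
    using isoB by (simp add: inclB_repB[OF \<beta>, symmetric] isometric_on_def)
  then show "norm (repB \<beta>) = norm \<beta>"
    using ess \<beta> by (simp add: norm_blinfun_eq_SUP strictly_essential_def)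
qed

text \<open>
  Both norms are the supremum of \<open>\<parallel>a w b\<parallel>\<close> over the unit balls: that of \<open>w\<close> by strict
  essentiality, that of the quasi-multiplier because \<open>\<Phi>\<close> is isometric.
\<close>

lemma repW_isometric: "isometric_on (modW E) repW"
  unfolding isometric_on_def
proof
  fix w
  assume w: "w \<in> modW E"
  have "norm (repW w a b) = norm (sandwich w a b)" for a b
    using isoV by (simp add: embV_repW[OF w, symmetric] isometric_on_def)
  then have "norm (repW w) =
      (SUP (a, b)\<in>{a. norm a \<le> 1} \<times> {b. norm b \<le> 1}. norm (sandwich w a b))"
    by (simp add: norm_QM_eq_SUP)
  also have "\<dots> = norm w"
    using ess w by (simp add: strictly_essential_def sandwich_def)
  finally show "norm (repW w) = norm w" .
qed

lemma repA_inclA: "repA (inclA E a) = blinfun_mult_left a"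
  by (auto intro!: blinfun_eqI inclA_eqD simp: inclA_repA inclA_in inclA_mult)

lemma repB_inclB: "repB (inclB E b) = blinfun_mult_right b"
  by (auto intro!: blinfun_eqI inclB_eqD simp: inclB_repB inclB_in inclB_mult)

lemma repW_embV: "repW (embV E x) = Gamma lact ract x"
  by (auto intro!: blinfun_eqI embV_eqD
      simp: embV_repW embV_in Gamma_apply embV_act sandwich_def)

text \<open>
  Moves the outer actions inwards: \<open>a (\<alpha> w \<beta>) b = (a \<alpha>) w (\<beta> b)\<close>, where \<open>a \<alpha>\<close> and \<open>\<beta> b\<close> belong
  again to \<open>A\<close> and \<open>B\<close>. With \<open>\<alpha>\<close> and \<open>\<beta>\<close> from the algebras it shows that \<open>W \<rightarrow> QM(V)\<close> respects
  the actions; with \<open>\<alpha>\<close> from \<open>A\<close> and \<open>\<beta>\<close> from \<open>B\<close> it gives the defining identity of a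
  quasi-multiplier.
\<close>

lemma sandwich_act:
  assumes w: "w \<in> modW E" and \<alpha>: "\<alpha> \<in> algA E" and \<beta>: "\<beta> \<in> algB E"
  shows "sandwich (actB E (actA E \<alpha> w) \<beta>) a b =
    actB E (actA E (multA E (inclA E a) \<alpha>) w) (multB E \<beta> (inclB E b))"
proof -
  have "sandwich (actB E (actA E \<alpha> w) \<beta>) a b =
      actB E (actB E (actA E (inclA E a) (actA E \<alpha> w)) \<beta>) (inclB E b)"
    using assms by (simp add: sandwich_def act_comm[symmetric] inclA_in actA_in)
  then show ?thesis
    using assms by (simp add: actA_mult actB_mult inclA_in inclB_in actA_in)
qed

lemma sandwich_sandwich:
  assumes w: "w \<in> modW E"
  shows "sandwich (sandwich w a b) c d = sandwich w (c * a) (b * d)"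
  using sandwich_act[OF w inclA_in inclB_in] by (simp add: sandwich_def inclA_mult inclB_mult)

lemma repW_in_QM:
  assumes w: "w \<in> modW E"
  shows "repW w \<in> QM lact ract"
proof -
  note scale = clinearV[unfolded clinear_on_def, simplified]
    sandwich_clinear[OF w, unfolded clinear_on_def, simplified]
  have "repW w (c * a) (b * d) = ract (lact c (repW w a b)) d" for a b c d
    using sandwich_sandwich[OF w, of a b c d]
    by (auto intro!: embV_eqD simp: embV_repW[OF w] embV_act sandwich_def)
  then show ?thesis
    unfolding QM_def by (auto intro!: embV_eqD simp: embV_repW[OF w] scale)
qed

lemma repW_clinear: "clinear_on (modW E) repW"
proof -
  have closed: "w + w' \<in> modW E" "c *\<^sub>C w \<in> modW E" if "w \<in> modW E" "w' \<in> modW E" for w w' c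
    using bimod that unfolding banach_bimodule_on_def banach_subspace_def
      complex_vector.subspace_def by blast+
  note lin = clinearV[unfolded clinear_on_def, simplified]
    sandwich_clinear_middle[unfolded clinear_on_def]
  show ?thesis
    unfolding clinear_on_def
    by (auto intro!: blinfun_eqI embV_eqD
        simp: embV_repW closed lin blinfun.add_left scaleC_blinfun.rep_eq)
qed

lemma repW_act:
  assumes "w \<in> modW E" "\<alpha> \<in> algA E" "\<beta> \<in> algB E"
  shows "repW (actB E (actA E \<alpha> w) \<beta>) = QM_ract (QM_lact (repA \<alpha>) (repW w)) (repB \<beta>)"
proof (intro blinfun_eqI embV_eqD)
  fix a b
  show "embV E (repW (actB E (actA E \<alpha> w) \<beta>) a b) =
      embV E (QM_ract (QM_lact (repA \<alpha>) (repW w)) (repB \<beta>) a b)"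
    using assms by (simp add: embV_repW actA_in actB_in sandwich_act QM_ract_apply QM_lact_apply
        sandwich_def[of w] inclA_repA inclB_repB)
qed

lemma embeds_QM: "quasi_ext_embeds E (QM_quasi_ext lact ract)"
  unfolding quasi_ext_embeds_def
  by (rule exI[of _ repA], rule exI[of _ repB], rule exI[of _ repW])
    (auto simp: QM_quasi_ext_def repA_hom repB_hom repA_isometric repB_isometric repW_isometric
      repA_inclA repB_inclB repW_embV repW_in_QM repW_clinear repW_act)

end

section \<open>Maximality\<close>

theorem theorem2p22:
  fixes lact :: "'a::cstar_algebra \<Rightarrow> 'v::cbanach \<Rightarrow> 'v"
    and ract :: "'v \<Rightarrow> 'b::cstar_algebra \<Rightarrow> 'v"
    and linner :: "'v \<Rightarrow> 'v \<Rightarrow> 'a"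
    and rinner :: "'v \<Rightarrow> 'v \<Rightarrow> 'b"
  assumes "hilbert_bimodule lact ract linner rinner"
  shows "maximal_strictly_essential TYPE('x::cbanach \<times> 'y::cbanach \<times> 'w::cbanach) lact ract
    (QM_quasi_ext lact ract)"
proof -
  interpret hilbert_bimodule lact ract linner rinner
    by (rule assms)
  have "quasi_ext_embeds E (QM_quasi_ext lact ract)"
    if "quasi_extension lact ract E" "strictly_essential E"
    for E :: "('a, 'b, 'v, 'x, 'y, 'w) quasi_ext"
  proof -
    interpret strictly_essential_extension lact ract linner rinner E
      by standard (fact that)+
    show ?thesis
      by (rule embeds_QM)
  qed
  then show ?thesis
    by (simp add: maximal_strictly_essential_def quasi_extension_QM strictly_essential_QM)
qed

end
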